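(* Let $T$ be a periodic tiling of $\mathbb{R}^d$ ($d\geqslant2$) with point group $G$, and let $\Gamma_+$ be its positive space group. There is an isomorphism $\pi_1(\Omega_G)\cong\Gamma_+$, and in fact an isomorphism between the standard extension $\mathbb{Z}^d\to\Gamma_+\to G$ of $\Gamma_+$ and the extension $\mathbb{Z}^d\to\pi_1(\Omega_G)\to G$ (with $\mathbb{Z}^d\cong\pi_1(\Omega_t)$) realised by the fibration $\Omega_t\to\Omega_G\to BG$.
   Context: A tiling of $\mathbb{R}^d$ is a cover of $\mathbb{R}^d$ by compact $d$-dimensional polyhedral subsets (tiles), possibly labelled, meeting full face to full face and only on boundaries, each tile being a translate of one of a finite set of prototiles. $T$ is periodic if its translational symmetries form a lattice $\cong\mathbb{Z}^d$ of full rank in $\mathbb{R}^d$. The positive space group $\Gamma_+$ is the group of all orientation preserving isometries of $\mathbb{R}^d$ preserving $T$. Its standard extension is $\mathbb{Z}^d\to\Gamma_+\to G$, where $\mathbb{Z}^d$ is the normal subgroup of translational symmetries and the (finite) point group $G\leq\mathrm{SO}(d)$ is the group of rotational parts of elements of $\Gamma_+$; equivalently $G=\{g\in\mathrm{SO}(d): g(T)\text{ is a translate of }T\}$. The translational hull $\Omega_t$ of $T$ is the space of tilings all of whose finite patches appear up to translation in $T$; for periodic $T$ it is the set of translates of $T$, a $d$-torus. The topology is that in which two tilings are close if they agree on a large ball about the origin after a small translation followed by a small rotation of either. $G$ acts on $\Omega_t$ by $g\cdot T'=g(T')$. With $EG$ a contractible free $G$-space and $BG=EG/G$, define $\Omega_G=(\Omega_t\times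 EG)/G$ (diagonal action); projection to the second factor gives the fibration $\Omega_t\to\Omega_G\to BG$, and $\pi_1(BG)=G$. All spaces are connected CW complexes up to homotopy and base points are omitted. *)

theory Defs
  imports
    "HOL-Analysis.Analysis"
    "HOL-Algebra.Group_Action"
    "HOL-Algebra.Product_Groups"
    "HOL-Algebra.Elementary_Groups"
begin

section \<open>Tilings\<close>

text \<open>A tile is a pair of a label and its support. Unlabelled tilings are the case where the
  label type is \<^typ>\<open>unit\<close>.\<close>

definition polyhedral_body :: "(real^'n) set \<Rightarrow> bool" where
  "polyhedral_body P \<longleftrightarrow>
     (\<exists>\<Q>. finite \<Q> \<and> \<Q> \<noteq> {} \<and> (\<forall>Q\<in>\<Q>. polytope Q \<and> interior Q \<noteq> {}) \<and> P = \<Union>\<Q>)"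

text \<open>Tiles need not be convex, so \<^const>\<open>face_of\<close> is not available for them. Two points of a
  polyhedral set lie in the same open stratum if the set looks the same near both, up to the
  translation carrying one point to the other; the faces are the closures of the connected
  components of the strata. For a full-dimensional convex polytope the strata are the relative
  interiors of the non-empty faces (including the polytope itself).\<close>

definition same_germ :: "'a::real_normed_vector set \<Rightarrow> 'a \<Rightarrow> 'a \<Rightarrow> bool" where
  "same_germ P x y \<longleftrightarrow> (\<exists>\<epsilon>>0. \<forall>v. norm v < \<epsilon> \<longrightarrow> (x + v \<in> P \<longleftrightarrow> y + v \<in> P))"

definition faces :: "'a::real_normed_vector set \<Rightarrow> 'a set set" where
  "faces P = (\<lambda>x. closure (connected_component_set {y \<in> P. same_germ P x y} x)) ` P"

definition meet_face_to_face :: "'a::real_normed_vector set \<Rightarrow> 'a set \<Rightarrow> bool" where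
  "meet_face_to_face P Q \<longleftrightarrow>
     P \<inter> Q \<subseteq> frontier P \<inter> frontier Q \<and> (\<exists>\<F> \<subseteq> faces P \<inter> faces Q. P \<inter> Q = \<Union>\<F>)"

definition move :: "('a \<Rightarrow> 'b) \<Rightarrow> ('l \<times> 'a set) set \<Rightarrow> ('l \<times> 'b set) set" where
  "move f T = map_prod id (image f) ` T"

definition tiling :: "('l \<times> (real^'n) set) set \<Rightarrow> bool" where
  "tiling T \<longleftrightarrow>
     (\<forall>t\<in>T. polyhedral_body (snd t)) \<and>
     (\<Union>t\<in>T. snd t) = UNIV \<and>
     (\<forall>s\<in>T. \<forall>t\<in>T. s \<noteq> t \<longrightarrow> meet_face_to_face (snd s) (snd t)) \<and>
     (\<exists>\<P>. finite \<P> \<and> (\<forall>t\<in>T. \<exists>p\<in>\<P>. \<exists>v. t = map_prod id (image (\<lambda>x. x + v)) p))"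

definition periods :: "('l \<times> (real^'n) set) set \<Rightarrow> (real^'n) set" where
  "periods T = {v. move (\<lambda>x. x + v) T = T}"

definition full_rank_lattice :: "(real^'n) set \<Rightarrow> bool" where
  "full_rank_lattice L \<longleftrightarrow>
     (\<exists>b :: 'n \<Rightarrow> real^'n. inj b \<and> independent (range b) \<and>
        L = range (\<lambda>k :: 'n \<Rightarrow> int. \<Sum>i\<in>UNIV. of_int (k i) *\<^sub>R b i))"

definition periodic_tiling :: "('l \<times> (real^'n) set) set \<Rightarrow> bool" where
  "periodic_tiling T \<longleftrightarrow> tiling T \<and> full_rank_lattice (periods T)"


section \<open>The positive space group and its standard extension\<close>

definition rot_part :: "(real^'n \<Rightarrow> real^'n) \<Rightarrow> real^'n \<Rightarrow> real^'n" where
  "rot_part f = (\<lambda>x. f x - f 0)"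

definition orientation_preserving_isometry :: "(real^'n \<Rightarrow> real^'n) \<Rightarrow> bool" where
  "orientation_preserving_isometry f \<longleftrightarrow>
     (\<forall>x y. dist (f x) (f y) = dist x y) \<and> det (matrix (rot_part f)) > 0"

definition comp_group :: "('a \<Rightarrow> 'a) set \<Rightarrow> ('a \<Rightarrow> 'a) monoid" where
  "comp_group S = \<lparr>carrier = S, mult = (\<circ>), one = id\<rparr>"

definition space_group :: "('l \<times> (real^'n) set) set \<Rightarrow> (real^'n \<Rightarrow> real^'n) monoid" where
  "space_group T = comp_group {f. orientation_preserving_isometry f \<and> move f T = T}"

definition translation_group :: "('l \<times> (real^'n) set) set \<Rightarrow> (real^'n \<Rightarrow> real^'n) monoid" where
  "translation_group T = comp_group ((\<lambda>v x. x + v) ` periods T)"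

definition point_group :: "('l \<times> (real^'n) set) set \<Rightarrow> (real^'n \<Rightarrow> real^'n) monoid" where
  "point_group T = comp_group (rot_part ` carrier (space_group T))"

definition Z_power :: "'n itself \<Rightarrow> ('n \<Rightarrow> int) monoid" where
  "Z_power _ = product_group (UNIV :: 'n set) (\<lambda>_. integer_group)"

text \<open>The library's \<open>short_exact_sequence\<close> requires the three groups to have the same element
  type.\<close>

definition group_extension ::
  "'a monoid \<Rightarrow> 'b monoid \<Rightarrow> 'c monoid \<Rightarrow> ('a \<Rightarrow> 'b) \<Rightarrow> ('b \<Rightarrow> 'c) \<Rightarrow> bool" where
  "group_extension N E Q i p \<longleftrightarrow>
     group N \<and> group E \<and> group Q \<and> i \<in> mon N E \<and> p \<in> epi E Q \<and> kernel E Q p = i ` carrier N"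


section \<open>The translational hull\<close>

definition hull_set :: "('l \<times> (real^'n) set) set \<Rightarrow> ('l \<times> (real^'n) set) set set" where
  "hull_set T =
     {T'. tiling T' \<and> (\<forall>P. finite P \<and> P \<subseteq> T' \<longrightarrow> (\<exists>v. move (\<lambda>x. x + v) P \<subseteq> T))}"

definition agree_on_ball ::
  "real \<Rightarrow> ('l \<times> (real^'n) set) set \<Rightarrow> ('l \<times> (real^'n) set) set \<Rightarrow> bool" where
  "agree_on_ball r T1 T2 \<longleftrightarrow>
     {t \<in> T1. snd t \<inter> ball 0 r \<noteq> {}} = {t \<in> T2. snd t \<inter> ball 0 r \<noteq> {}}"

definition agree_after_motion ::
  "real \<Rightarrow> ('l \<times> (real^'n) set) set \<Rightarrow> ('l \<times> (real^'n) set) set \<Rightarrow> bool" where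
  "agree_after_motion \<epsilon> T1 T2 \<longleftrightarrow>
     (\<exists>v g. norm v < \<epsilon> \<and>
        orthogonal_transformation g \<and> det (matrix g) = 1 \<and> onorm (\<lambda>x. g x - x) < \<epsilon> \<and>
        agree_on_ball (1 / \<epsilon>) (move g (move (\<lambda>x. x + v) T1)) T2)"

definition close_tilings ::
  "real \<Rightarrow> ('l \<times> (real^'n) set) set \<Rightarrow> ('l \<times> (real^'n) set) set \<Rightarrow> bool" where
  "close_tilings \<epsilon> T1 T2 \<longleftrightarrow> agree_after_motion \<epsilon> T1 T2 \<or> agree_after_motion \<epsilon> T2 T1"

definition transl_hull :: "('l \<times> (real^'n) set) set \<Rightarrow> ('l \<times> (real^'n) set) set topology" where
  "transl_hull T = topology (\<lambda>U. U \<subseteq> hull_set T \<and>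
     (\<forall>T1\<in>U. \<exists>\<epsilon>>0. \<forall>T2\<in>hull_set T. close_tilings \<epsilon> T1 T2 \<longrightarrow> T2 \<in> U))"

lemma agree_after_motion_mono:
  assumes "agree_after_motion \<epsilon> T1 T2" "0 < \<epsilon>" "\<epsilon> \<le> \<delta>"
  shows "agree_after_motion \<delta> T1 T2"
proof -
  have "ball (0 :: real^'n) (1 / \<delta>) \<subseteq> ball 0 (1 / \<epsilon>)"
    using assms(2,3) by (intro subset_ball) (simp add: frac_le)
  then have "agree_on_ball (1 / \<delta>) A B" if "agree_on_ball (1 / \<epsilon>) A B"
    for A B :: "('a \<times> (real^'n) set) set"
    using that unfolding agree_on_ball_def set_eq_iff mem_Collect_eq by blast
  with assms show ?thesis
    unfolding agree_after_motion_def by (meson less_le_trans)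
qed

lemma openin_transl_hull:
  "openin (transl_hull T) U \<longleftrightarrow> U \<subseteq> hull_set T \<and>
     (\<forall>T1\<in>U. \<exists>\<epsilon>>0. \<forall>T2\<in>hull_set T. close_tilings \<epsilon> T1 T2 \<longrightarrow> T2 \<in> U)"
proof -
  let ?N = "\<lambda>U. \<forall>T1\<in>U. \<exists>\<epsilon>>0. \<forall>T2\<in>hull_set T. close_tilings \<epsilon> T1 T2 \<longrightarrow> T2 \<in> U"
  have mono: "close_tilings \<delta> A B" if "close_tilings \<epsilon> A B" "0 < \<epsilon>" "\<epsilon> \<le> \<delta>"
    for \<epsilon> \<delta> and A B :: "('a \<times> (real^'b) set) set"
    using that agree_after_motion_mono unfolding close_tilings_def by blast
  have "istopology (\<lambda>U. U \<subseteq> hull_set T \<and> ?N U)"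
    unfolding istopology_def
  proof (intro conjI allI impI)
    fix S S' assume S: "S \<subseteq> hull_set T \<and> ?N S" and S': "S' \<subseteq> hull_set T \<and> ?N S'"
    show "S \<inter> S' \<subseteq> hull_set T" using S by blast
    show "?N (S \<inter> S')"
    proof
      fix T1 assume "T1 \<in> S \<inter> S'"
      with S S' obtain a b where ab: "a > 0" "b > 0"
        "\<forall>T2\<in>hull_set T. close_tilings a T1 T2 \<longrightarrow> T2 \<in> S"
        "\<forall>T2\<in>hull_set T. close_tilings b T1 T2 \<longrightarrow> T2 \<in> S'"
        by blast
      then have "0 < min a b" by simp
      moreover have "\<forall>T2\<in>hull_set T. close_tilings (min a b) T1 T2 \<longrightarrow> T2 \<in> S \<inter> S'"
        using ab mono[OF _ \<open>0 < min a b\<close>] by (meson IntI min.cobounded1 min.cobounded2)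
      ultimately show "\<exists>\<epsilon>>0. \<forall>T2\<in>hull_set T. close_tilings \<epsilon> T1 T2 \<longrightarrow> T2 \<in> S \<inter> S'"
        by blast
    qed
  next
    fix \<K> assume K: "\<forall>K\<in>\<K>. K \<subseteq> hull_set T \<and> ?N K"
    show "\<Union>\<K> \<subseteq> hull_set T" using K by blast
    show "?N (\<Union>\<K>)" using K by (meson UnionE UnionI)
  qed
  then show ?thesis
    unfolding transl_hull_def by (simp add: topology_inverse')
qed

lemma topspace_transl_hull [simp]: "topspace (transl_hull T) = hull_set T"
proof -
  have "openin (transl_hull T) (hull_set T)"
    unfolding openin_transl_hull using zero_less_one by blast
  then show ?thesis
    by (metis openin_transl_hull openin_subset openin_topspace subset_antisym)
qed


section \<open>Orbit spaces and the Borel construction\<close>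

definition orbit_space ::
  "('g, 'z) monoid_scheme \<Rightarrow> 'a topology \<Rightarrow> ('g \<Rightarrow> 'a \<Rightarrow> 'a) \<Rightarrow> 'a set topology" where
  "orbit_space G X \<phi> = topology (\<lambda>U. U \<subseteq> orbits G (topspace X) \<phi> \<and>
     openin X {x \<in> topspace X. orbit G \<phi> x \<in> U})"

lemma openin_orbit_space:
  fixes X :: "'a topology"
  shows "openin (orbit_space G X \<phi>) U \<longleftrightarrow> U \<subseteq> orbits G (topspace X) \<phi> \<and>
     openin X {x \<in> topspace X. orbit G \<phi> x \<in> U}"
proof -
  have "istopology (\<lambda>U. U \<subseteq> orbits G (topspace X) \<phi> \<and>
     openin X {x \<in> topspace X. orbit G \<phi> x \<in> U})"
    unfolding istopology_def
  proof (intro conjI allI impI)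
    fix S S' :: "'a set set"
    assume S: "S \<subseteq> orbits G (topspace X) \<phi> \<and> openin X {x \<in> topspace X. orbit G \<phi> x \<in> S}"
      and S': "S' \<subseteq> orbits G (topspace X) \<phi> \<and> openin X {x \<in> topspace X. orbit G \<phi> x \<in> S'}"
    show "S \<inter> S' \<subseteq> orbits G (topspace X) \<phi>" using S by blast
    have "{x \<in> topspace X. orbit G \<phi> x \<in> S \<inter> S'} =
      {x \<in> topspace X. orbit G \<phi> x \<in> S} \<inter> {x \<in> topspace X. orbit G \<phi> x \<in> S'}" by blast
    then show "openin X {x \<in> topspace X. orbit G \<phi> x \<in> S \<inter> S'}" using S S' by auto
  next
    fix \<K> :: "'a set set set"
    assume K: "\<forall>K\<in>\<K>. K \<subseteq> orbits G (topspace X) \<phi> \<and>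
      openin X {x \<in> topspace X. orbit G \<phi> x \<in> K}"
    show "\<Union>\<K> \<subseteq> orbits G (topspace X) \<phi>" using K by blast
    have "{x \<in> topspace X. orbit G \<phi> x \<in> \<Union>\<K>} =
      (\<Union>K\<in>\<K>. {x \<in> topspace X. orbit G \<phi> x \<in> K})" by blast
    then show "openin X {x \<in> topspace X. orbit G \<phi> x \<in> \<Union>\<K>}" using K by auto
  qed
  then show ?thesis
    unfolding orbit_space_def by (simp add: topology_inverse')
qed

text \<open>For a finite group acting freely, the Hausdorff condition makes the quotient map a covering
  (free actions on non-Hausdorff spaces need not be properly discontinuous).
  \<^const>\<open>group_action\<close> presents the maps \<open>\<phi> g\<close> as functions restricted to the space.\<close>

definition free_G_space ::
  "('g, 'z) monoid_scheme \<Rightarrow> 'e topology \<Rightarrow> ('g \<Rightarrow> 'e \<Rightarrow> 'e) \<Rightarrow> bool" where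
  "free_G_space G X \<phi> \<longleftrightarrow>
     Hausdorff_space X \<and> group_action G (topspace X) \<phi> \<and>
     (\<forall>g\<in>carrier G. continuous_map X X (\<phi> g)) \<and>
     (\<forall>g\<in>carrier G. \<forall>x\<in>topspace X. \<phi> g x = x \<longrightarrow> g = \<one>\<^bsub>G\<^esub>)"

definition diagonal_action ::
  "(('a \<Rightarrow> 'a) \<Rightarrow> 'e \<Rightarrow> 'e) \<Rightarrow> ('a \<Rightarrow> 'a) \<Rightarrow> ('l \<times> 'a set) set \<times> 'e \<Rightarrow> ('l \<times> 'a set) set \<times> 'e" where
  "diagonal_action \<phi> g = (\<lambda>(T', y). (move g T', \<phi> g y))"

definition borel_hull ::
  "('l \<times> (real^'n) set) set \<Rightarrow> 'e topology \<Rightarrow> ((real^'n \<Rightarrow> real^'n) \<Rightarrow> 'e \<Rightarrow> 'e)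
     \<Rightarrow> (('l \<times> (real^'n) set) set \<times> 'e) set topology" where
  "borel_hull T EG \<phi> =
     orbit_space (point_group T) (prod_topology (transl_hull T) EG) (diagonal_action \<phi>)"

definition classifying_space ::
  "('l \<times> (real^'n) set) set \<Rightarrow> 'e topology \<Rightarrow> ((real^'n \<Rightarrow> real^'n) \<Rightarrow> 'e \<Rightarrow> 'e)
     \<Rightarrow> 'e set topology" where
  "classifying_space T EG \<phi> = orbit_space (point_group T) EG \<phi>"

definition borel_fibre ::
  "('l \<times> (real^'n) set) set \<Rightarrow> ((real^'n \<Rightarrow> real^'n) \<Rightarrow> 'e \<Rightarrow> 'e) \<Rightarrow> 'e
     \<Rightarrow> ('l \<times> (real^'n) set) set \<Rightarrow> (('l \<times> (real^'n) set) set \<times> 'e) set" where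
  "borel_fibre T \<phi> e = (\<lambda>T'. orbit (point_group T) (diagonal_action \<phi>) (T', e))"

text \<open>The second projection sends the orbit of \<open>(T', y)\<close> to the orbit of \<open>y\<close>, which is the image
  of the former under \<^const>\<open>snd\<close>.\<close>

definition borel_projection :: "('a \<times> 'e) set \<Rightarrow> 'e set" where
  "borel_projection c = snd ` c"


section \<open>Fundamental groups of abstract topologies\<close>

definition loops :: "'a topology \<Rightarrow> 'a \<Rightarrow> (real \<Rightarrow> 'a) set" where
  "loops X x = {p. pathin X p \<and> p 0 = x \<and> p 1 = x}"

definition loop_rel :: "'a topology \<Rightarrow> 'a \<Rightarrow> ((real \<Rightarrow> 'a) \<times> (real \<Rightarrow> 'a)) set" where
  "loop_rel X x = {(p, q). p \<in> loops X x \<and> q \<in> loops X x \<and>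
     homotopic_with (\<lambda>r. r 0 = x \<and> r 1 = x) (top_of_set {0..1}) X p q}"

text \<open>Same formula as \<^const>\<open>joinpaths\<close>, which is restricted to types of class
  \<^class>\<open>topological_space\<close>.\<close>

definition join :: "(real \<Rightarrow> 'a) \<Rightarrow> (real \<Rightarrow> 'a) \<Rightarrow> real \<Rightarrow> 'a" where
  "join p q = (\<lambda>t. if t \<le> 1/2 then p (2 * t) else q (2 * t - 1))"

definition fundamental_group :: "'a topology \<Rightarrow> 'a \<Rightarrow> (real \<Rightarrow> 'a) set monoid" where
  "fundamental_group X x =
     \<lparr>carrier = loops X x // loop_rel X x,
      mult = (\<lambda>A B. \<Union>p\<in>A. \<Union>q\<in>B. loop_rel X x `` {join p q}),
      one = loop_rel X x `` {\<lambda>_. x}\<rparr>"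

definition induced_map ::
  "'b topology \<Rightarrow> 'b \<Rightarrow> ('a \<Rightarrow> 'b) \<Rightarrow> (real \<Rightarrow> 'a) set \<Rightarrow> (real \<Rightarrow> 'b) set" where
  "induced_map Y y f A = (\<Union>p\<in>A. loop_rel Y y `` {f \<circ> p})"

text \<open>The canonical identification of the fundamental group of \<open>X/G\<close> with \<open>G\<close>, for a simply
  connected free \<open>G\<close>-space \<open>X\<close> with base point \<open>e\<close>: a loop is sent to the \<open>g\<close> for which its lift
  starting at \<open>e\<close> ends at \<open>\<phi> g e\<close>.\<close>

definition monodromy ::
  "('g, 'z) monoid_scheme \<Rightarrow> 'e topology \<Rightarrow> ('g \<Rightarrow> 'e \<Rightarrow> 'e) \<Rightarrow> 'e \<Rightarrow> (real \<Rightarrow> 'e set) set \<Rightarrow> 'g" where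
  "monodromy G X \<phi> e A = (THE g. g \<in> carrier G \<and>
     (\<exists>p. pathin X p \<and> p 0 = e \<and> p 1 = \<phi> g e \<and> orbit G \<phi> \<circ> p \<in> A))"

end

theory Submission
  imports Defs
begin

text \<open>
  Write \<open>L\<close> for the lattice of periods of \<open>T\<close>. Two tilings of the hull that are close differ by a small
  translation only, because a rotation involved would map \<open>L\<close> to itself and be close to the identity.
  Hence the hull is the torus of translates \<open>T - y\<close>, with universal covering \<open>y \<mapsto> T - y\<close> and deck group \<open>L\<close>.
  The space group acts on \<open>\<real>\<^sup>d \<times> EG\<close> by \<open>f (y, e) = (f y, rot_part f \<cdot> e)\<close>, freely and properly
  discontinuously, and \<open>(y, e) \<mapsto> [T - y, e]\<close> identifies the quotient with the Borel construction. As
  \<open>\<real>\<^sup>d \<times> EG\<close> is contractible, its deck group \<open>\<Gamma>\<^sub>+\<close> is the fundamental group. The maps \<open>y \<mapsto> (y, e0)\<close> and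
  \<open>(y, e) \<mapsto> e\<close> cover the inclusion of the fibre and the projection to \<open>BG\<close>, and on deck groups they induce
  the inclusion of \<open>L\<close> and \<open>rot_part\<close>. The group axioms of the fundamental groups are transported along the
  bijections with the deck groups.
\<close>

section \<open>Paths and homotopies\<close>

text \<open>The long exact sequence of the fibration would give exactness but leave the group in the
  middle to be identified. Instead, all three base spaces are quotients of contractible ones, so a
  homotopy class is determined by where the lift of a loop ends, and each fundamental group becomes
  a concrete group of maps. Exactness is then only checked for isometries of R^d.

  The obstacle is that the hull, \<open>EG\<close> and the Borel construction are abstract
  topologies. A covering is therefore taken to be an action together with an open surjection whose
  fibres are the orbits, and sheets are compared by group elements. Proper discontinuity on the
  product uses both factors: a small open set of \<open>EG\<close> forces the rotational part to be
  trivial, what remains is translation by a period, and a small ball excludes all periods but 0. The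
  first half rests on finiteness of the point group: a rotation in it is determined by the images of
  finitely many periods, and these images have finitely many possible values.\<close>

lemma continuous_map_in_topspace: "continuous_map X Y f \<Longrightarrow> x \<in> topspace X \<Longrightarrow> f x \<in> topspace Y"
  using continuous_map_image_subset_topspace by fastforce

text \<open>Continuity is asked on the neighbourhood \<open>N\<close> only, because lifts built from
  a local section are defined only near a given parameter.\<close>

lemma eventually_continuous_map:
  assumes "continuous_map (subtopology X N) Y f" "openin X N" "x \<in> N" "openin Y U" "f x \<in> U"
  shows "eventually (\<lambda>x. f x \<in> U) (nhdsin X x)"
proof -
  let ?S = "{x \<in> topspace (subtopology X N). f x \<in> U}"
  have "openin X ?S"
    using openin_continuous_map_preimage[OF assms(1,4)] assms(2) openin_trans_full by blast
  moreover have "x \<in> ?S"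
    using assms openin_subset by fastforce
  ultimately show ?thesis
    unfolding eventually_nhdsin by blast
qed

lemma eventually_continuous_map':
  assumes "continuous_map X Y f" "x \<in> topspace X" "openin Y U" "f x \<in> U"
  shows "eventually (\<lambda>x. f x \<in> U) (nhdsin X x)"
  using eventually_continuous_map[of X "topspace X" Y f x U] assms by simp

text \<open>Connectedness of the interval. It serves twice: for the deck element relating two lifts
  of a path, and for the end point of a lift as the homotopy parameter varies.\<close>

lemma locally_constant_on_interval:
  fixes f :: "real \<Rightarrow> 'b"
  assumes "\<And>t. t \<in> {a..b} \<Longrightarrow> eventually (\<lambda>s. f s = f t) (nhdsin (top_of_set {a..b}) t)"
    and "s \<in> {a..b}" "t \<in> {a..b}"
  shows "f s = f t"
proof (rule connected_local_const[of "{a..b}"])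
  show "\<forall>x\<in>{a..b}. eventually (\<lambda>y. f x = f y) (at x within {a..b})"
  proof
    fix x assume x: "x \<in> {a..b}"
    then obtain S where S: "openin (top_of_set {a..b}) S" "x \<in> S" "\<forall>y\<in>S. f y = f x"
      using assms(1)[OF x] by (auto simp: eventually_nhdsin)
    then obtain T where "open T" "S = {a..b} \<inter> T"
      by (auto simp: openin_open)
    with S show "eventually (\<lambda>y. f x = f y) (at x within {a..b})"
      unfolding eventually_at_topological by (metis IntI IntD2)
  qed
qed (use assms in auto)

lemma prod_unit_intervals:
  "prod_topology (top_of_set {0..1::real}) (top_of_set {0..1::real}) = top_of_set ({0..1} \<times> {0..1})"
  by (simp add: subtopology_Times euclidean_product_topology)

lemma pathin_join:
  assumes "pathin X p" "pathin X q" "p 1 = q 0"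
  shows "pathin X (join p q)"
  unfolding pathin_def join_def
proof (rule continuous_map_cases_le)
  have p: "continuous_map (top_of_set {0..1}) X p" and q: "continuous_map (top_of_set {0..1}) X q"
    using assms by (auto simp: pathin_def)
  have "continuous_map (subtopology (top_of_set {0..1}) {t \<in> topspace (top_of_set {0..1}). t \<le> 1/2})
     (top_of_set {0..1}) (\<lambda>t::real. 2 * t)"
    by (auto simp: subtopology_subtopology intro!: continuous_intros)
  from continuous_map_compose[OF this p]
  show "continuous_map (subtopology (top_of_set {0..1}) {t \<in> topspace (top_of_set {0..1}). t \<le> 1/2})
     X (\<lambda>t. p (2 * t))"
    by (simp add: o_def)
  have "continuous_map (subtopology (top_of_set {0..1}) {t \<in> topspace (top_of_set {0..1}). 1/2 \<le> t})
     (top_of_set {0..1}) (\<lambda>t::real. 2 * t - 1)"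
    by (auto simp: subtopology_subtopology intro!: continuous_intros)
  from continuous_map_compose[OF this q]
  show "continuous_map (subtopology (top_of_set {0..1}) {t \<in> topspace (top_of_set {0..1}). 1/2 \<le> t})
     X (\<lambda>t. q (2 * t - 1))"
    by (simp add: o_def)
  show "p (2 * t) = q (2 * t - 1)" if "t = 1/2" for t
    unfolding that using assms(3) by simp
qed (auto intro!: continuous_intros)

text \<open>A path and a contraction \<open>H\<close> yield a path homotopic to the given one: follow the track of the
  initial point under \<open>H\<close>, stay at the limit point, and return along the track of the final point.
  It depends only on the end points.\<close>

lemma contractible_space_homotopic_paths:
  assumes "contractible_space X" "pathin X p" "pathin X q" "p 0 = x" "q 0 = x" "p 1 = y" "q 1 = y"
  shows "homotopic_with (\<lambda>r. r 0 = x \<and> r 1 = y) (top_of_set {0..1}) X p q"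
proof -
  let ?I = "top_of_set {0..1::real}"
  let ?P = "\<lambda>r. r 0 = x \<and> r 1 = y"
  obtain H c where H: "continuous_map (prod_topology ?I X) X H" "\<And>z. H (0, z) = z" "\<And>z. H (1, z) = c"
    using assms(1) unfolding contractible_space_def homotopic_with_def by auto
  \<comment> \<open>\<open>A p\<close> waits at the initial point for a third of the time, runs
    through \<open>p\<close> in the middle third and waits at the final point. \<open>B p\<close>
    applies the contraction to it, with contraction time rising from 0 to 1, staying at 1, and
    falling back to 0 on the three thirds.\<close>
  define A where "A = (\<lambda>p :: real \<Rightarrow> 'a. \<lambda>t. p (max 0 (min 1 (3 * t - 1))))"
  define B where "B = (\<lambda>p t. H (min 1 (max 0 (min (3 * t) (3 - 3 * t))), A p t))"
  have hom: "homotopic_with ?P ?I X r (B r)" if r: "pathin X r" "r 0 = x" "r 1 = y" for r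
  proof (rule homotopic_with_trans)
    have contr: "continuous_map ?I X r"
      using r by (simp add: pathin_def)
    show "homotopic_with ?P ?I X r (A r)"
      unfolding homotopic_with_def
    proof (intro exI conjI allI ballI)
      \<comment> \<open>Linear interpolation between the identity and the clamped parameter; it
        stays in the unit interval by convexity and fixes 0 and 1.\<close>
      let ?k = "\<lambda>z::real \<times> real. (1 - fst z) * snd z + fst z * max 0 (min 1 (3 * snd z - 1))"
      have bound: "?k z \<in> {0..1}" if "z \<in> {0..1} \<times> {0..1}" for z
      proof -
        obtain s t where z: "z = (s, t)" "0 \<le> s" "s \<le> 1" "0 \<le> t" "t \<le> 1"
          using \<open>z \<in> _\<close> by auto
        show ?thesis
          using convex_bound_le[of t 1 "max 0 (min 1 (3 * t - 1))" "1 - s" s] z by simp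
      qed
      have "continuous_map (prod_topology ?I ?I) ?I ?k"
        unfolding prod_unit_intervals using bound by (auto intro!: continuous_intros)
      from continuous_map_compose[OF this contr]
      show "continuous_map (prod_topology ?I ?I) X (r \<circ> ?k)" .
    qed (auto simp: A_def r)
    have A: "continuous_map ?I X (A r)"
    proof -
      have "continuous_map ?I ?I (\<lambda>t. max 0 (min 1 (3 * t - 1)))"
        by (auto intro!: continuous_intros)
      from continuous_map_compose[OF this contr] show ?thesis
        by (simp add: A_def o_def)
    qed
    show "homotopic_with ?P ?I X (A r) (B r)"
      unfolding homotopic_with_def
    proof (intro exI conjI allI ballI)
      \<comment> \<open>The contraction time is cut off at the homotopy parameter. At both ends of
        the path it is 0 anyway, so the end points stay fixed.\<close>
      let ?k = "\<lambda>z::real \<times> real. (min (fst z) (max 0 (min (3 * snd z) (3 - 3 * snd z))), A r (snd z))"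
      have "continuous_map (prod_topology ?I ?I) ?I
              (\<lambda>z. min (fst z) (max 0 (min (3 * snd z) (3 - 3 * snd z))))"
        unfolding prod_unit_intervals by (auto intro!: continuous_intros)
      moreover have "continuous_map (prod_topology ?I ?I) X (\<lambda>z. A r (snd z))"
        using continuous_map_compose[OF continuous_map_snd A] by (simp only: o_def)
      ultimately have "continuous_map (prod_topology ?I ?I) (prod_topology ?I X) ?k"
        by (rule continuous_map_pairedI)
      from continuous_map_compose[OF this H(1)]
      show "continuous_map (prod_topology ?I ?I) X (H \<circ> ?k)" .
    qed (auto simp: A_def B_def H r)
  qed
  have "B p t = B q t" if "t \<in> {0..1}" for t
  proof -
    \<comment> \<open>In the outer thirds only the initial or the final point enters, and in the
      middle third the contraction time is 1, so the value is the limit point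
      \<open>c\<close>.\<close>
    consider "3 * t - 1 \<le> 0" | "3 * t - 1 \<ge> 1" | "3 * t > 1" "3 * t < 2" by linarith
    then show ?thesis
      by cases (use assms H in \<open>auto simp: A_def B_def\<close>)
  qed
  then have "homotopic_with ?P ?I X (B p) (B q)"
    using homotopic_with_imp_continuous_maps[OF hom[OF assms(2,4,6)]]
      homotopic_with_imp_property[OF hom[OF assms(2,4,6)]]
      homotopic_with_imp_property[OF hom[OF assms(3,5,7)]]
    by (intro homotopic_with_equal) auto
  with hom[OF assms(2,4,6)] hom[OF assms(3,5,7)] show ?thesis
    by (meson homotopic_with_symD homotopic_with_trans)
qed


section \<open>Covering actions\<close>

text \<open>The laws are required on the points of the space only. Unlike in
  \<open>group_action\<close>, the maps need not be undefined elsewhere, which suits actions given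
  by plain formulas such as \<open>diagonal_action\<close> and
  \<open>space_group_action\<close>.\<close>

locale continuous_action = group \<Gamma>
  for \<Gamma> :: "'g monoid" (structure) +
  fixes X :: "'x topology" and \<psi> :: "'g \<Rightarrow> 'x \<Rightarrow> 'x"
  assumes cont_act: "\<gamma> \<in> carrier \<Gamma> \<Longrightarrow> continuous_map X X (\<psi> \<gamma>)"
    and act_one: "x \<in> topspace X \<Longrightarrow> \<psi> \<one> x = x"
    and act_mult: "\<lbrakk>\<gamma> \<in> carrier \<Gamma>; \<delta> \<in> carrier \<Gamma>; x \<in> topspace X\<rbrakk> \<Longrightarrow> \<psi> (\<gamma> \<otimes> \<delta>) x = \<psi> \<gamma> (\<psi> \<delta> x)"
begin

lemma act_closed: "\<lbrakk>\<gamma> \<in> carrier \<Gamma>; x \<in> topspace X\<rbrakk> \<Longrightarrow> \<psi> \<gamma> x \<in> topspace X"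
  using cont_act continuous_map_in_topspace by metis

lemma act_inv: "\<lbrakk>\<gamma> \<in> carrier \<Gamma>; x \<in> topspace X\<rbrakk> \<Longrightarrow> \<psi> (inv \<gamma>) (\<psi> \<gamma> x) = x"
  using act_mult[of "inv \<gamma>" \<gamma> x] act_one by simp

end

text \<open>The base is an arbitrary space \<open>Y\<close> with a map \<open>q\<close>, not
  \<open>orbit_space\<close>: the hull is not literally an orbit space of R^d, and the Borel
  construction is an orbit space of the point group but is covered here by an action of the space
  group. The last condition contains freeness as well as proper discontinuity.\<close>

locale covering_action = continuous_action +
  fixes Y :: "'c topology" and q :: "'b \<Rightarrow> 'c"
  assumes cont_q: "continuous_map X Y q"
    and open_q: "open_map X Y q"
    and surj_q: "q ` topspace X = topspace Y"
    and fibre: "\<lbrakk>x \<in> topspace X; x' \<in> topspace X\<rbrakk> \<Longrightarrow> q x = q x' \<longleftrightarrow> (\<exists>\<gamma>\<in>carrier \<Gamma>. x' = \<psi> \<gamma> x)"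
    and wandering: "x \<in> topspace X \<Longrightarrow>
      \<exists>U. openin X U \<and> x \<in> U \<and> (\<forall>\<gamma>\<in>carrier \<Gamma>. \<forall>u\<in>U. \<psi> \<gamma> u \<in> U \<longrightarrow> \<gamma> = \<one>)"
begin

lemma q_act: "\<lbrakk>\<gamma> \<in> carrier \<Gamma>; x \<in> topspace X\<rbrakk> \<Longrightarrow> q (\<psi> \<gamma> x) = q x"
  using fibre act_closed by metis

lemma act_free:
  assumes "\<gamma> \<in> carrier \<Gamma>" "\<delta> \<in> carrier \<Gamma>" "x \<in> topspace X" "\<psi> \<gamma> x = \<psi> \<delta> x"
  shows "\<gamma> = \<delta>"
proof -
  have "\<psi> (inv \<delta> \<otimes> \<gamma>) x = x"
    using assms act_mult act_inv by simp
  then have "inv \<delta> \<otimes> \<gamma> = \<one>"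
    using wandering[OF assms(3)] assms by (metis m_closed inv_closed)
  then show ?thesis
    using assms by (metis inv_solve_left one_closed r_one)
qed

lemma q_locally_injective:
  assumes "x \<in> topspace X"
  obtains U where "openin X U" "x \<in> U" "inj_on q U"
proof -
  obtain U where U: "openin X U" "x \<in> U" "\<forall>\<gamma>\<in>carrier \<Gamma>. \<forall>u\<in>U. \<psi> \<gamma> u \<in> U \<longrightarrow> \<gamma> = \<one>"
    using wandering[OF assms] by (elim exE conjE)
  have "inj_on q U"
  proof (rule inj_onI)
    fix u v assume uv: "u \<in> U" "v \<in> U" "q u = q v"
    then have "u \<in> topspace X" "v \<in> topspace X"
      using U(1) openin_subset by blast+
    then show "u = v"
      using uv U(3) fibre act_one by metis
  qed
  with U that show thesis by blast
qed

text \<open>On a wandering neighbourhood \<open>q\<close> is injective and open, so its inverse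
  there is continuous on an open image.\<close>

lemma local_section:
  assumes "y \<in> topspace Y"
  obtains V \<sigma> where "openin Y V" "y \<in> V" "continuous_map (subtopology Y V) X \<sigma>" "\<And>v. v \<in> V \<Longrightarrow> q (\<sigma> v) = v"
    "\<And>v. v \<in> V \<Longrightarrow> \<sigma> v \<in> topspace X"
proof -
  obtain x where x: "x \<in> topspace X" "q x = y"
    using assms surj_q by (metis imageE)
  then obtain U where U: "openin X U" "x \<in> U" "inj_on q U"
    using q_locally_injective by blast
  have UX: "U \<subseteq> topspace X"
    using U openin_subset by blast
  let ?\<sigma> = "inv_into U q"
  have V: "openin Y (q ` U)"
    using U open_q by (simp add: open_map_def)
  have cont: "continuous_map (subtopology Y (q ` U)) X ?\<sigma>"
    unfolding continuous_map_def
  proof (intro conjI allI impI)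
    show "?\<sigma> \<in> topspace (subtopology Y (q ` U)) \<rightarrow> topspace X"
      using UX U(3) by auto
    fix W assume W: "openin X W"
    have "{v \<in> topspace (subtopology Y (q ` U)). ?\<sigma> v \<in> W} = q ` (U \<inter> W)"
      using U(3) openin_subset[OF V] by auto
    moreover have "openin Y (q ` (U \<inter> W))"
      using U W open_q by (simp add: open_map_def openin_Int)
    ultimately show "openin (subtopology Y (q ` U)) {v \<in> topspace (subtopology Y (q ` U)). ?\<sigma> v \<in> W}"
      by (metis Int_lower1 image_mono subset_openin_subtopology)
  qed
  show thesis
  proof (rule that[OF V _ cont])
    show "y \<in> q ` U" using x U(2) by blast
    show "q (?\<sigma> v) = v" if "v \<in> q ` U" for v
      using f_inv_into_f[OF that] .
    show "?\<sigma> v \<in> topspace X" if "v \<in> q ` U" for v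
      using inv_into_into[OF that] UX by blast
  qed
qed

text \<open>At each time the two lifts differ by a unique deck element \<open>\<gamma> t\<close>.
  Translating the second lift by the inverse of \<open>\<gamma> t\<close> makes both pass through
  the same wandering set \<open>U\<close> near time \<open>t\<close>; then
  \<open>inv (\<gamma> t) \<otimes> \<gamma> s\<close> moves a point of \<open>U\<close> into
  \<open>U\<close> and is trivial. So \<open>\<gamma>\<close> is locally constant, and it is
  \<open>\<one>\<close> at the start.\<close>

lemma unique_lift:
  assumes p: "continuous_map (top_of_set {a..b::real}) X p" and p': "continuous_map (top_of_set {a..b}) X p'"
    and eq: "\<And>t. t \<in> {a..b} \<Longrightarrow> q (p t) = q (p' t)" and start: "p a = p' a" and t: "t \<in> {a..b}"
  shows "p t = p' t"
proof -
  have pX: "p t \<in> topspace X" "p' t \<in> topspace X" if "t \<in> {a..b}" for t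
    using continuous_map_in_topspace[OF p] continuous_map_in_topspace[OF p'] that by simp_all
  have "\<exists>\<gamma>. \<gamma> \<in> carrier \<Gamma> \<and> p' t = \<psi> \<gamma> (p t)" if "t \<in> {a..b}" for t
    using fibre[OF pX[OF that]] eq[OF that] by blast
  then obtain \<gamma> where \<gamma>: "\<And>t. t \<in> {a..b} \<Longrightarrow> \<gamma> t \<in> carrier \<Gamma> \<and> p' t = \<psi> (\<gamma> t) (p t)"
    by metis
  have "\<gamma> t = \<gamma> a"
  proof (rule locally_constant_on_interval)
    fix t assume t: "t \<in> {a..b}"
    obtain U where U: "openin X U" "p t \<in> U" "\<forall>\<gamma>\<in>carrier \<Gamma>. \<forall>u\<in>U. \<psi> \<gamma> u \<in> U \<longrightarrow> \<gamma> = \<one>"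
      using wandering[OF pX(1)[OF t]] by (elim exE conjE)
    have g: "continuous_map (top_of_set {a..b}) X (\<psi> (inv (\<gamma> t)) \<circ> p')"
      using continuous_map_compose[OF p' cont_act] \<gamma>[OF t] by simp
    have "(\<psi> (inv (\<gamma> t)) \<circ> p') t \<in> U"
      using \<gamma>[OF t] act_inv pX[OF t] U by simp
    then have "eventually (\<lambda>s. (\<psi> (inv (\<gamma> t)) \<circ> p') s \<in> U) (nhdsin (top_of_set {a..b}) t)"
      using t U(1) by (intro eventually_continuous_map'[OF g]) auto
    moreover have "eventually (\<lambda>s. p s \<in> U) (nhdsin (top_of_set {a..b}) t)"
      using t U(1,2) by (intro eventually_continuous_map'[OF p]) auto
    moreover have "eventually (\<lambda>s. s \<in> {a..b}) (nhdsin (top_of_set {a..b}) t)"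
      unfolding eventually_nhdsin using t openin_topspace[of "top_of_set {a..b}"] by auto
    ultimately show "eventually (\<lambda>s. \<gamma> s = \<gamma> t) (nhdsin (top_of_set {a..b}) t)"
    proof eventually_elim
      case (elim s)
      then have "\<psi> (inv (\<gamma> t) \<otimes> \<gamma> s) (p s) \<in> U"
        using \<gamma>[OF t] \<gamma>[of s] act_mult pX[of s] by simp
      then have "inv (\<gamma> t) \<otimes> \<gamma> s = \<one>"
        using U(3) elim \<gamma>[OF t] \<gamma>[of s] by auto
      then show ?case
        using \<gamma>[OF t] \<gamma>[of s] elim by (metis inv_solve_left one_closed r_one)
    qed
  qed (use t in auto)
  moreover have a: "a \<in> {a..b}" using t by auto
  have "\<psi> (\<gamma> a) (p a) = \<psi> \<one> (p a)"
    using \<gamma>[OF a] start act_one[OF pX(1)[OF a]] by metis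
  then have "\<gamma> a = \<one>"
    using act_free \<gamma>[OF a] pX(1)[OF a] by blast
  ultimately show ?thesis
    using \<gamma>[OF t] act_one[OF pX(1)[OF t]] by metis
qed

lemma path_lift:
  assumes r: "pathin Y r" and x: "x \<in> topspace X" "q x = r 0"
  obtains p where "pathin X p" "p 0 = x" "\<And>t. t \<in> {0..1} \<Longrightarrow> q (p t) = r t"
proof -
  \<comment> \<open>Lifts are demanded from every point over \<open>r a\<close>; this makes
    \<open>P\<close> additive over adjacent intervals, so that Bolzano's principle reduces the claim
    to short intervals.\<close>
  define P where "P = (\<lambda>a b. 0 \<le> a \<and> a \<le> b \<and> b \<le> 1 \<longrightarrow> (\<forall>x\<in>topspace X. q x = r a \<longrightarrow>
    (\<exists>p. continuous_map (top_of_set {a..b}) X p \<and> p a = x \<and> (\<forall>t\<in>{a..b}. q (p t) = r t))))"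
  have contr: "continuous_map (top_of_set {0..1}) Y r"
    using r by (simp add: pathin_def)
  have "0 \<le> (1::real)" by simp
  then have "P 0 1"
  proof (induction rule: Bolzano)
    case (trans a b c)
    show ?case
      unfolding P_def
    proof (intro impI ballI)
      fix x assume abc: "0 \<le> a \<and> a \<le> c \<and> c \<le> 1" and x: "x \<in> topspace X" "q x = r a"
      obtain p where p: "continuous_map (top_of_set {a..b}) X p" "p a = x" "\<forall>t\<in>{a..b}. q (p t) = r t"
        using trans abc x unfolding P_def by fastforce
      have "p b \<in> topspace X" "q (p b) = r b"
        using p trans by (force simp: continuous_map_def)+
      then obtain p' where p': "continuous_map (top_of_set {b..c}) X p'" "p' b = p b" "\<forall>t\<in>{b..c}. q (p' t) = r t"
        using trans abc unfolding P_def by fastforce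
      have "continuous_map (top_of_set {a..c}) X (\<lambda>t. if t \<le> b then p t else p' t)"
      proof (rule continuous_map_cases_le)
        have "{a..c} \<inter> {t. a \<le> t \<and> t \<le> c \<and> t \<le> b} = {a..b}" "{a..c} \<inter> {t. a \<le> t \<and> t \<le> c \<and> b \<le> t} = {b..c}"
          using trans by auto
        with p(1) p'(1)
        show "continuous_map (subtopology (top_of_set {a..c}) {t \<in> topspace (top_of_set {a..c}). t \<le> b}) X p"
          "continuous_map (subtopology (top_of_set {a..c}) {t \<in> topspace (top_of_set {a..c}). b \<le> t}) X p'"
          by (simp_all add: subtopology_subtopology)
      qed (use p'(2) in \<open>auto intro!: continuous_intros\<close>)
      then show "\<exists>p. continuous_map (top_of_set {a..c}) X p \<and> p a = x \<and> (\<forall>t\<in>{a..c}. q (p t) = r t)"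
        using p p' trans by (intro exI[of _ "\<lambda>t. if t \<le> b then p t else p' t"]) auto
    qed
  next
    case (local u)
    then have u: "u \<in> {0..1}" by auto
    then have "r u \<in> topspace Y"
      using contr by (force simp: continuous_map_def)
    then obtain V \<sigma> where V: "openin Y V" "r u \<in> V" "continuous_map (subtopology Y V) X \<sigma>"
        "\<And>v. v \<in> V \<Longrightarrow> q (\<sigma> v) = v" "\<And>v. v \<in> V \<Longrightarrow> \<sigma> v \<in> topspace X"
      using local_section by blast
    have "openin (top_of_set {0..1}) {t \<in> {0..1}. r t \<in> V}"
      using openin_continuous_map_preimage[OF contr V(1)] by simp
    then obtain d where d: "d > 0" "\<And>t. t \<in> {0..1} \<Longrightarrow> dist t u < d \<Longrightarrow> r t \<in> V"
      using u V(2) unfolding openin_euclidean_subtopology_iff by blast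
    show ?case
    proof (intro exI[of _ d] conjI allI impI d(1))
      fix a b assume ab: "a \<le> u \<and> u \<le> b \<and> b - a < d"
      show "P a b"
        unfolding P_def
      proof (intro impI ballI)
        fix x assume abc: "0 \<le> a \<and> a \<le> b \<and> b \<le> 1" and x: "x \<in> topspace X" "q x = r a"
        have rV: "r t \<in> V" if "t \<in> {a..b}" for t
          using d(2)[of t] that ab abc by (auto simp: dist_real_def)
        have "r a \<in> V"
          using rV abc by simp
        then have \<sigma>a: "\<sigma> (r a) \<in> topspace X" "q (\<sigma> (r a)) = q x"
          using V(4,5) x(2) by simp_all
        \<comment> \<open>The section over \<open>V\<close> need not start at the prescribed point
          \<open>x\<close>; a deck element corrects it.\<close>
        then obtain \<gamma> where \<gamma>: "\<gamma> \<in> carrier \<Gamma>" "x = \<psi> \<gamma> (\<sigma> (r a))"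
          using fibre x by blast
        have "continuous_map (top_of_set {a..b}) (subtopology Y V) r"
          using continuous_map_from_subtopology_mono[OF contr, of "{a..b}"] abc rV
          by (auto simp: continuous_map_in_subtopology)
        then have "continuous_map (top_of_set {a..b}) X (\<psi> \<gamma> \<circ> (\<sigma> \<circ> r))"
          by (rule continuous_map_compose[OF continuous_map_compose[OF _ V(3)] cont_act[OF \<gamma>(1)]])
        moreover have "q ((\<psi> \<gamma> \<circ> (\<sigma> \<circ> r)) t) = r t" if "t \<in> {a..b}" for t
        proof -
          have "\<sigma> (r t) \<in> topspace X"
            using V(5) rV[OF that] by blast
          then show ?thesis
            using q_act[OF \<gamma>(1)] V(4)[OF rV[OF that]] by simp
        qed
        ultimately show "\<exists>p. continuous_map (top_of_set {a..b}) X p \<and> p a = x \<and> (\<forall>t\<in>{a..b}. q (p t) = r t)"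
          using \<gamma> by (intro exI[of _ "\<psi> \<gamma> \<circ> (\<sigma> \<circ> r)"]) auto
      qed
    qed
  qed
  then have "\<exists>p. continuous_map (top_of_set {0..1}) X p \<and> p 0 = x \<and> (\<forall>t\<in>{0..1}. q (p t) = r t)"
    using x by (simp add: P_def)
  then obtain p where p: "continuous_map (top_of_set {0..1}) X p" "p 0 = x" "\<forall>t\<in>{0..1}. q (p t) = r t"
    by (elim exE conjE)
  show thesis
  proof (rule that)
    show "pathin X p" using p(1) by (simp only: pathin_def)
    show "p 0 = x" by (fact p(2))
    show "q (p t) = r t" if "t \<in> {0..1}" for t using p(3) that by (rule bspec)
  qed
qed

text \<open>The lifts of the intermediate loops of a homotopy vary continuously; this is propagated along
  the path parameter, so that no two-dimensional subdivision is needed.\<close>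

lemma homotopic_lifts_same_end:
  assumes hom: "homotopic_with (\<lambda>r. r 0 = y \<and> r 1 = z) (top_of_set {0..1}) Y r r'"
    and p: "pathin X p" "\<And>t. t \<in> {0..1} \<Longrightarrow> q (p t) = r t"
    and p': "pathin X p'" "\<And>t. t \<in> {0..1} \<Longrightarrow> q (p' t) = r' t"
    and start: "p 0 = p' 0"
  shows "p 1 = p' 1"
proof -
  let ?I = "top_of_set {0..1::real}"
  obtain h where h: "continuous_map (prod_topology ?I ?I) Y h"
    and h01: "\<forall>t. h (0, t) = r t" "\<forall>t. h (1, t) = r' t"
      "\<forall>s\<in>{0..1}. h (s, 0) = y \<and> h (s, 1) = z"
    using hom unfolding homotopic_with_def by (elim exE conjE)
  note h = h h01[rule_format]
  have hY: "h (s, t) \<in> topspace Y" if "s \<in> {0..1}" "t \<in> {0..1}" for s t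
    using continuous_map_image_subset_topspace[OF h(1)] that by auto
  have hs: "continuous_map ?I Y (\<lambda>t. h (s, t))" if "s \<in> {0..1}" for s
    using continuous_map_o_Pair[OF h(1)] that by (simp add: o_def)
  have ht: "continuous_map ?I Y (\<lambda>s. h (s, t))" if "t \<in> {0..1}" for t
  proof -
    have "continuous_map ?I (prod_topology ?I ?I) (\<lambda>s. (s, t))"
      using that by (intro continuous_map_pairedI) auto
    from continuous_map_compose[OF this h(1)] show ?thesis by (simp add: o_def)
  qed
  \<comment> \<open>All intermediate paths start at \<open>y\<close>, so each can be lifted from the
    same point \<open>p 0\<close>. Nothing yet relates the lifts for different
    \<open>s\<close>.\<close>
  have "\<exists>P. pathin X P \<and> P 0 = p 0 \<and> (\<forall>t\<in>{0..1}. q (P t) = h (s, t))" if s: "s \<in> {0..1}" for s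
  proof -
    have "q (p 0) = h (s, 0)"
      using p(2)[of 0] h(2)[of 0] h(4)[of 0] h(4)[OF s] by simp
    moreover have "pathin Y (\<lambda>t. h (s, t))"
      using hs[OF s] by (simp add: pathin_def)
    ultimately show ?thesis
      using path_lift[of "\<lambda>t. h (s, t)" "p 0"] path_start_in_topspace[OF p(1)] by metis
  qed
  then obtain P where P: "\<And>s. s \<in> {0..1} \<Longrightarrow> pathin X (P s)" "\<And>s. s \<in> {0..1} \<Longrightarrow> P s 0 = p 0"
      "\<And>s t. s \<in> {0..1} \<Longrightarrow> t \<in> {0..1} \<Longrightarrow> q (P s t) = h (s, t)"
    by metis
  have contP: "continuous_map (top_of_set {a..b}) X (P s)" if "s \<in> {0..1}" "0 \<le> a" "b \<le> 1" for a b s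
    using P(1)[OF that(1)] that unfolding pathin_def
    by (elim continuous_map_from_subtopology_mono) auto
  have PX: "P s t \<in> topspace X" if "s \<in> {0..1}" "t \<in> {0..1}" for s t
    using contP[of s 0 1] that by (force simp: continuous_map_def)
  \<comment> \<open>Continuity at \<open>s0\<close> of the point that the chosen lifts reach at time
    \<open>t\<close>, as a function of \<open>s\<close>. It is trivial at time 0 and needed at time
    1.\<close>
  define C where "C = (\<lambda>s0 t. \<forall>U. openin X U \<and> P s0 t \<in> U \<longrightarrow> eventually (\<lambda>s. P s t \<in> U) (nhdsin ?I s0))"
  have evI: "eventually (\<lambda>s. s \<in> {0..1}) (nhdsin ?I s0)" if "s0 \<in> {0..1}" for s0
    unfolding eventually_nhdsin using that openin_topspace[of ?I] by auto
  have C1: "C s0 1" if s0: "s0 \<in> {0..1}" for s0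
  proof -
    define Q where "Q = (\<lambda>a b. 0 \<le> a \<and> a \<le> b \<and> b \<le> 1 \<longrightarrow> C s0 a \<longrightarrow> C s0 b)"
    have "0 \<le> (1::real)" by simp
    then have "Q 0 1"
    proof (induction rule: Bolzano)
      case (trans a b c)
      then show ?case by (auto simp: Q_def)
    next
      case (local u)
      then have u: "u \<in> {0..1}" by auto
      obtain V \<sigma> where V: "openin Y V" "h (s0, u) \<in> V" "continuous_map (subtopology Y V) X \<sigma>"
          "\<And>v. v \<in> V \<Longrightarrow> q (\<sigma> v) = v" "\<And>v. v \<in> V \<Longrightarrow> \<sigma> v \<in> topspace X"
        using local_section[OF hY[OF s0 u]] by blast
      have *: "openin (prod_topology ?I ?I) {z \<in> topspace (prod_topology ?I ?I). h z \<in> V}"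
        using openin_continuous_map_preimage[OF h(1) V(1)] .
      have **: "(s0, u) \<in> {z \<in> topspace (prod_topology ?I ?I). h z \<in> V}"
        using s0 u V by simp
      \<comment> \<open>On the box \<open>N \<times> M\<close> the homotopy stays in one sectioned
        set \<open>V\<close>, so a translate of the section composed with \<open>h\<close> is a lift
        that is continuous in each variable.\<close>
      obtain N M where NM: "openin ?I N" "openin ?I M" "s0 \<in> N" "u \<in> M"
          "N \<times> M \<subseteq> {z \<in> topspace (prod_topology ?I ?I). h z \<in> V}"
        using iffD1[OF openin_prod_topology_alt * , rule_format, OF **] by (elim exE conjE)
      have hV: "h (s, t) \<in> V" if "s \<in> N" "t \<in> M" for s t
        using NM that by blast
      obtain d where d: "d > 0" "\<And>t. t \<in> {0..1} \<Longrightarrow> dist t u < d \<Longrightarrow> t \<in> M"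
        using NM(2,4) unfolding openin_euclidean_subtopology_iff by blast
      have NI: "N \<subseteq> {0..1}" "M \<subseteq> {0..1}"
        using openin_subset[OF NM(1)] openin_subset[OF NM(2)] by simp_all
      show ?case
        unfolding Q_def
      proof (intro exI[of _ d] conjI allI impI d(1))
        fix a b assume ab: "a \<le> u \<and> u \<le> b \<and> b - a < d" and ab': "0 \<le> a \<and> a \<le> b \<and> b \<le> 1" and Ca: "C s0 a"
        have M: "t \<in> M" if "t \<in> {a..b}" for t
          using d(2)[of t] that ab ab' by (auto simp: dist_real_def)
        have aM: "a \<in> M" "b \<in> M" using M ab' by auto
        have a01: "a \<in> {0..1}" "b \<in> {0..1}" using ab' by auto
        have \<sigma>X: "\<sigma> v \<in> topspace X" if "v \<in> V" for v
          using V(5) that .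
        have "q (P s0 a) = q (\<sigma> (h (s0, a)))"
          using P(3)[OF s0 a01(1)] V(4)[OF hV[OF NM(3) aM(1)]] by simp
        then obtain \<gamma> where \<gamma>: "\<gamma> \<in> carrier \<Gamma>" "P s0 a = \<psi> \<gamma> (\<sigma> (h (s0, a)))"
          using fibre[OF \<sigma>X[OF hV[OF NM(3) aM(1)]] PX[OF s0 a01(1)]] by auto
        define g where "g = (\<lambda>s t. \<psi> \<gamma> (\<sigma> (h (s, t))))"
        have qg: "q (g s t) = h (s, t)" if "s \<in> N" "t \<in> M" for s t
          using q_act[OF \<gamma>(1) \<sigma>X[OF hV[OF that]]] V(4)[OF hV[OF that]] by (simp add: g_def)
        have gt: "continuous_map (subtopology ?I N) X (\<lambda>s. g s t)" if "t \<in> M" for t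
        proof -
          have "continuous_map (subtopology ?I N) (subtopology Y V) (\<lambda>s. h (s, t))"
            using ht[of t] NI that hV by (auto simp: continuous_map_in_subtopology continuous_map_from_subtopology)
          then have "continuous_map (subtopology ?I N) X (\<psi> \<gamma> \<circ> (\<sigma> \<circ> (\<lambda>s. h (s, t))))"
            by (rule continuous_map_compose[OF continuous_map_compose[OF _ V(3)] cont_act[OF \<gamma>(1)]])
          then show ?thesis by (simp add: g_def o_def)
        qed
        have gs: "continuous_map (top_of_set {a..b}) X (g s)" if "s \<in> N" for s
        proof -
          have "continuous_map (top_of_set {a..b}) Y (\<lambda>t. h (s, t))"
            using NI that ab' by (intro continuous_map_from_subtopology_mono[OF hs]) auto
          then have "continuous_map (top_of_set {a..b}) (subtopology Y V) (\<lambda>t. h (s, t))"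
            using hV[OF that] M by (auto simp: continuous_map_in_subtopology)
          then have "continuous_map (top_of_set {a..b}) X (\<psi> \<gamma> \<circ> (\<sigma> \<circ> (\<lambda>t. h (s, t))))"
            by (rule continuous_map_compose[OF continuous_map_compose[OF _ V(3)] cont_act[OF \<gamma>(1)]])
          then show ?thesis by (simp add: g_def[abs_def] o_def)
        qed
        have lift: "P s b = g s b" if "s \<in> N" "P s a = g s a" for s
        proof (rule unique_lift[of a b])
          show "continuous_map (top_of_set {a..b}) X (P s)"
            using contP NI that ab' by blast
          show "q (P s t) = q (g s t)" if "t \<in> {a..b}" for t
            using P(3)[of s t] qg[OF \<open>s \<in> N\<close> M[OF that]] \<open>s \<in> N\<close> NI that ab' by auto
        qed (use that gs ab' in auto)
        obtain U where U: "openin X U" "P s0 a \<in> U" "inj_on q U"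
          using q_locally_injective[OF PX[OF s0 a01(1)]] by blast
        have evN: "eventually (\<lambda>s. s \<in> N) (nhdsin ?I s0)"
          unfolding eventually_nhdsin using NM(1,3) by blast
        have "eventually (\<lambda>s. P s a \<in> U) (nhdsin ?I s0)"
          using Ca U by (simp add: C_def)
        moreover have "eventually (\<lambda>s. g s a \<in> U) (nhdsin ?I s0)"
          using eventually_continuous_map[OF gt[OF aM(1)] NM(1,3) U(1)] U(2) \<gamma> by (simp add: g_def)
        \<comment> \<open>At time \<open>a\<close> both lifts lie over \<open>h (s, a)\<close> and,
          for \<open>s\<close> near \<open>s0\<close>, in a set where \<open>q\<close> is injective.
          Hence they agree there, and by uniqueness of lifts also at time \<open>b\<close>.\<close>
        ultimately have ev: "eventually (\<lambda>s. P s b = g s b) (nhdsin ?I s0)"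
          using evN
        proof eventually_elim
          case (elim s)
          have "q (P s a) = q (g s a)"
            using P(3)[of s a] qg[OF elim(3) aM(1)] elim NI a01 by auto
          then have "P s a = g s a"
            using inj_onD[OF U(3)] elim by blast
          then show ?case using lift elim by blast
        qed
        have g0: "P s0 b = g s0 b"
          using lift[OF NM(3)] \<gamma> by (simp add: g_def)
        show "C s0 b"
          unfolding C_def
        proof (intro allI impI)
          fix W assume W: "openin X W \<and> P s0 b \<in> W"
          then have "eventually (\<lambda>s. g s b \<in> W) (nhdsin ?I s0)"
            using eventually_continuous_map[OF gt[OF aM(2)] NM(1,3)] g0 by simp
          with ev show "eventually (\<lambda>s. P s b \<in> W) (nhdsin ?I s0)"
            by eventually_elim simp
        qed
      qed
    qed
    moreover have "C s0 0"
      unfolding C_def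
    proof (intro allI impI)
      fix U assume U: "openin X U \<and> P s0 0 \<in> U"
      show "eventually (\<lambda>s. P s 0 \<in> U) (nhdsin ?I s0)"
        using evI[OF s0] by eventually_elim (use U P(2) s0 in auto)
    qed
    ultimately show ?thesis by (simp add: Q_def)
  qed
  have "P 0 1 = P 1 1"
  \<comment> \<open>All the end points lie over the single point \<open>z\<close>, and near
    \<open>s0\<close> they stay in a set where \<open>q\<close> is injective.\<close>
  proof (rule locally_constant_on_interval[of 0 1 "\<lambda>s. P s 1"])
    fix s0 :: real assume s0: "s0 \<in> {0..1}"
    obtain U where U: "openin X U" "P s0 1 \<in> U" "inj_on q U"
      using q_locally_injective[OF PX[OF s0, of 1]] by auto
    have "eventually (\<lambda>s. P s 1 \<in> U) (nhdsin ?I s0)"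
      using C1[OF s0] U by (simp add: C_def)
    then show "eventually (\<lambda>s. P s 1 = P s0 1) (nhdsin ?I s0)"
      using evI[OF s0]
    proof eventually_elim
      case (elim s)
      then have "q (P s 1) = q (P s0 1)"
        using P(3)[of s 1] P(3)[OF s0, of 1] h(4)[of s] h(4)[OF s0] by simp
      with elim U show ?case by (auto dest: inj_onD)
    qed
  qed auto
  moreover have "p 1 = P 0 1"
    by (rule unique_lift[of 0 1])
      (use p P(1-3)[of 0] h(2) in \<open>simp_all add: pathin_def\<close>)
  moreover have "p' 1 = P 1 1"
    by (rule unique_lift[of 0 1])
      (use p' P(1-3)[of 1] h(3) start in \<open>simp_all add: pathin_def\<close>)
  ultimately show ?thesis by simp
qed

end

section \<open>The fundamental group of a quotient of a contractible space\<close>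

locale universal_covering_action = covering_action +
  fixes x0
  assumes base: "x0 \<in> topspace X" and contractible: "contractible_space X"
begin

definition is_lift :: "(real \<Rightarrow> 'c) \<Rightarrow> 'a \<Rightarrow> (real \<Rightarrow> 'b) \<Rightarrow> bool" where
  "is_lift r \<gamma> p \<longleftrightarrow> \<gamma> \<in> carrier \<Gamma> \<and> pathin X p \<and> p 0 = x0 \<and> p 1 = \<psi> \<gamma> x0 \<and> (\<forall>t\<in>{0..1}. q (p t) = r t)"

definition deck :: "(real \<Rightarrow> 'c) \<Rightarrow> 'a" where
  "deck r = (THE \<gamma>. \<exists>p. is_lift r \<gamma> p)"

text \<open>This set turns out to be one full homotopy class of loops, so it serves as the inverse
  of the identification with the deck group.\<close>

definition deck_class :: "'a \<Rightarrow> (real \<Rightarrow> 'c) set" where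
  "deck_class \<gamma> = {r \<in> loops Y (q x0). deck r = \<gamma>}"

lemma is_liftD:
  assumes "is_lift r \<gamma> p"
  shows "\<gamma> \<in> carrier \<Gamma>" "pathin X p" "p 0 = x0" "p 1 = \<psi> \<gamma> x0" "\<And>t. t \<in> {0..1} \<Longrightarrow> q (p t) = r t"
  using assms by (simp_all add: is_lift_def)

lemma deck_eq:
  assumes lift: "is_lift r \<gamma> p"
  shows "deck r = \<gamma>"
  unfolding deck_def
proof (rule the_equality)
  show "\<exists>p. is_lift r \<gamma> p"
    using lift by (rule exI[of _ p])
next
  fix \<delta> assume "\<exists>p. is_lift r \<delta> p"
  then obtain p' where lift': "is_lift r \<delta> p'" ..
  have "p 1 = p' 1"
    by (rule unique_lift[of 0 1])
      (use is_liftD(2,3,5)[OF lift] is_liftD(2,3,5)[OF lift'] in \<open>simp_all add: pathin_def\<close>)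
  then show "\<delta> = \<gamma>"
    using act_free[OF is_liftD(1)[OF lift'] is_liftD(1)[OF lift] base]
    by (simp only: is_liftD(4)[OF lift] is_liftD(4)[OF lift'])
qed

lemma loop_lift:
  assumes r: "r \<in> loops Y (q x0)"
  obtains p where "is_lift r (deck r) p"
proof -
  have r': "pathin Y r" "r 0 = q x0" "r 1 = q x0"
    using r by (auto simp: loops_def)
  obtain p where p: "pathin X p" "p 0 = x0" "\<And>t. t \<in> {0..1} \<Longrightarrow> q (p t) = r t"
    using path_lift[OF r'(1) base r'(2)[symmetric]] by metis
  have "q x0 = q (p 1)"
    using p(3)[of 1] r' by simp
  then obtain \<gamma> where \<gamma>: "\<gamma> \<in> carrier \<Gamma>" "p 1 = \<psi> \<gamma> x0"
    using fibre[OF base path_finish_in_topspace[OF p(1)]] by blast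
  have "is_lift r \<gamma> p"
    unfolding is_lift_def using \<gamma> p by (intro conjI ballI)
  with deck_eq[OF this] that show thesis by simp
qed

lemma is_lift_deck_class:
  assumes "is_lift r \<gamma> p"
  shows "r \<in> deck_class \<gamma>"
proof -
  note p = is_liftD[OF assms]
  have "continuous_map (top_of_set {0..1}) Y (q \<circ> p)"
    using p(2) cont_q unfolding pathin_def by (rule continuous_map_compose)
  then have "continuous_map (top_of_set {0..1}) Y r"
    by (rule continuous_map_eq) (use p(5) in auto)
  moreover have "r 0 = q x0" "r 1 = q x0"
    using p(5)[of 0] p(5)[of 1] p(3) p(4) q_act[OF p(1) base] by simp_all
  ultimately show ?thesis
    using deck_eq[OF assms] by (simp add: deck_class_def loops_def pathin_def)
qed

lemma deck_class_loop: "r \<in> deck_class \<gamma> \<Longrightarrow> r \<in> loops Y (q x0)"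
  by (simp add: deck_class_def)

lemma deck_class_lift:
  assumes "r \<in> deck_class \<gamma>"
  obtains p where "is_lift r \<gamma> p"
proof -
  have r: "r \<in> loops Y (q x0)" "deck r = \<gamma>"
    using assms by (simp_all add: deck_class_def)
  obtain p where "is_lift r (deck r) p"
    by (rule loop_lift[OF r(1)])
  with r(2) that show thesis by simp
qed

text \<open>Path connectedness of the contractible space joins \<open>x0\<close> to each of its deck
  translates, so every deck element is realised by a loop.\<close>

lemma lift_in_deck_class:
  assumes "\<gamma> \<in> carrier \<Gamma>"
  obtains p where "is_lift (q \<circ> p) \<gamma> p"
proof -
  have "\<exists>p. pathin X p \<and> p 0 = x0 \<and> p 1 = \<psi> \<gamma> x0"
    using contractible_imp_path_connected_space[OF contractible] base act_closed[OF assms base]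
    unfolding path_connected_space_def by metis
  then obtain p where "pathin X p \<and> p 0 = x0 \<and> p 1 = \<psi> \<gamma> x0" ..
  then have "is_lift (q \<circ> p) \<gamma> p"
    using assms by (simp add: is_lift_def)
  then show thesis by (rule that)
qed

lemma deck_class_nonempty: "\<gamma> \<in> carrier \<Gamma> \<Longrightarrow> deck_class \<gamma> \<noteq> {}"
  using lift_in_deck_class is_lift_deck_class by (metis empty_iff)

text \<open>Homotopic loops have lifts with the same end, and freeness recovers the deck element
  from it. Conversely, lifts with the same ends are homotopic in the contractible space, and
  \<open>q\<close> carries that homotopy down.\<close>

lemma loop_rel_iff:
  "(r, r') \<in> loop_rel Y (q x0) \<longleftrightarrow> r \<in> loops Y (q x0) \<and> r' \<in> loops Y (q x0) \<and> deck r = deck r'"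
proof (cases "r \<in> loops Y (q x0) \<and> r' \<in> loops Y (q x0)")
  case True
  let ?P = "\<lambda>f. f 0 = q x0 \<and> f 1 = q x0"
  obtain p where "is_lift r (deck r) p"
    by (rule loop_lift[OF conjunct1[OF True]])
  note p = is_liftD[OF this]
  obtain p' where "is_lift r' (deck r') p'"
    by (rule loop_lift[OF conjunct2[OF True]])
  note p' = is_liftD[OF this]
  have start: "p 0 = p' 0"
    by (simp only: p(3) p'(3))
  have "homotopic_with ?P (top_of_set {0..1}) Y r r' \<longleftrightarrow> deck r = deck r'"
  proof
    assume "homotopic_with ?P (top_of_set {0..1}) Y r r'"
    then have "p 1 = p' 1"
      by (rule homotopic_lifts_same_end[OF _ p(2) p(5) p'(2) p'(5) start])
    then show "deck r = deck r'"
      using act_free[OF p(1) p'(1) base] by (simp only: p(4) p'(4))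
  next
    assume eq: "deck r = deck r'"
    then have "homotopic_with (\<lambda>f. f 0 = x0 \<and> f 1 = p 1) (top_of_set {0..1}) X p p'"
      by (intro contractible_space_homotopic_paths[OF contractible p(2) p'(2) p(3) p'(3)])
        (simp_all only: p(4) p'(4))
    then have "homotopic_with ?P (top_of_set {0..1}) Y (q \<circ> p) (q \<circ> p')"
      by (rule homotopic_with_compose_continuous_map_left[OF _ cont_q]) (auto simp: p(4) q_act[OF p(1) base])
    \<comment> \<open>The functions \<open>r\<close> and \<open>q \<circ> p\<close> agree only on
      the unit interval, so they need not be equal; they are homotopic all the same.\<close>
    moreover have "homotopic_with ?P (top_of_set {0..1}) Y r (q \<circ> p)"
      using True p(3-5) by (intro homotopic_with_equal) (simp_all add: loops_def pathin_def q_act[OF p(1) base])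
    moreover have "homotopic_with ?P (top_of_set {0..1}) Y r' (q \<circ> p')"
      using True p'(3-5) by (intro homotopic_with_equal) (simp_all add: loops_def pathin_def q_act[OF p'(1) base])
    ultimately show "homotopic_with ?P (top_of_set {0..1}) Y r r'"
      by (meson homotopic_with_symD homotopic_with_trans)
  qed
  with True show ?thesis
    by (simp add: loop_rel_def)
qed (auto simp: loop_rel_def)

lemma loop_rel_class: "r \<in> deck_class \<gamma> \<Longrightarrow> loop_rel Y (q x0) `` {r} = deck_class \<gamma>"
  by (auto simp: loop_rel_iff deck_class_def)

text \<open>The second lift has to be moved by \<open>\<psi> \<gamma>\<close> to start where the
  first one ends. The joined lift then ends at \<open>\<psi> \<gamma> (\<psi> \<delta> x0)\<close>,
  which gives the product in the order of the concatenation, hence a homomorphism and not an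
  antihomomorphism.\<close>

lemma join_deck_class:
  assumes "r \<in> deck_class \<gamma>" "s \<in> deck_class \<delta>"
  shows "join r s \<in> deck_class (\<gamma> \<otimes> \<delta>)"
proof -
  obtain p where "is_lift r \<gamma> p"
    by (rule deck_class_lift[OF assms(1)])
  note p = is_liftD[OF this]
  obtain p' where "is_lift s \<delta> p'"
    by (rule deck_class_lift[OF assms(2)])
  note p' = is_liftD[OF this]
  have "p' t \<in> topspace X" if "t \<in> {0..1}" for t
    using path_image_subset_topspace[OF p'(2)] that by blast
  then have q': "q (\<psi> \<gamma> (p' t)) = s t" if "t \<in> {0..1}" for t
    using that p'(5) q_act[OF p(1)] by metis
  have "pathin X (\<psi> \<gamma> \<circ> p')"
    by (rule pathin_compose[OF p'(2) cont_act[OF p(1)]])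
  then have "pathin X (join p (\<psi> \<gamma> \<circ> p'))"
    by (rule pathin_join[OF p(2)]) (simp add: p(4) p'(3))
  moreover have "q (join p (\<psi> \<gamma> \<circ> p') t) = join r s t" if "t \<in> {0..1}" for t
    using p(5)[of "2 * t"] q'[of "2 * t - 1"] that by (simp add: join_def)
  ultimately have "is_lift (join r s) (\<gamma> \<otimes> \<delta>) (join p (\<psi> \<gamma> \<circ> p'))"
    using p(1,3) p'(1,4) act_mult[OF p(1) p'(1) base] by (simp add: is_lift_def join_def)
  then show ?thesis by (rule is_lift_deck_class)
qed

lemma const_deck_class: "(\<lambda>_. q x0) \<in> deck_class \<one>"
  by (rule is_lift_deck_class[where p = "\<lambda>_. x0"]) (simp add: is_lift_def base act_one)

lemma carrier_fundamental_group: "carrier (fundamental_group Y (q x0)) = deck_class ` carrier \<Gamma>"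
proof -
  have "loops Y (q x0) // loop_rel Y (q x0) = deck_class ` carrier \<Gamma>"
  proof (intro subset_antisym subsetI)
    fix A assume "A \<in> loops Y (q x0) // loop_rel Y (q x0)"
    then obtain r where r: "r \<in> loops Y (q x0)" "A = loop_rel Y (q x0) `` {r}"
      by (auto elim: quotientE)
    have "r \<in> deck_class (deck r)"
      using r(1) by (simp add: deck_class_def)
    then have "A = deck_class (deck r)"
      using r(2) loop_rel_class by simp
    moreover have "deck r \<in> carrier \<Gamma>"
      using is_liftD(1) by (rule loop_lift[OF r(1)])
    ultimately show "A \<in> deck_class ` carrier \<Gamma>" by blast
  next
    fix A assume "A \<in> deck_class ` carrier \<Gamma>"
    then obtain \<gamma> where \<gamma>: "\<gamma> \<in> carrier \<Gamma>" "A = deck_class \<gamma>" by blast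
    then obtain r where "r \<in> deck_class \<gamma>"
      using deck_class_nonempty by auto
    with \<gamma> show "A \<in> loops Y (q x0) // loop_rel Y (q x0)"
      using loop_rel_class deck_class_loop quotientI by metis
  qed
  then show ?thesis by (simp add: fundamental_group_def)
qed

text \<open>The union defining the product runs over representatives, each contributing the same
  class; it equals that class because both factors are nonempty.\<close>

lemma mult_deck_class:
  assumes "\<gamma> \<in> carrier \<Gamma>" "\<delta> \<in> carrier \<Gamma>"
  shows "deck_class \<gamma> \<otimes>\<^bsub>fundamental_group Y (q x0)\<^esub> deck_class \<delta> = deck_class (\<gamma> \<otimes> \<delta>)"
proof -
  have "loop_rel Y (q x0) `` {join r s} = deck_class (\<gamma> \<otimes> \<delta>)" if "r \<in> deck_class \<gamma>" "s \<in> deck_class \<delta>" for r s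
    by (rule loop_rel_class[OF join_deck_class[OF that]])
  moreover have "deck_class \<gamma> \<noteq> {}" "deck_class \<delta> \<noteq> {}"
    using deck_class_nonempty assms by simp_all
  ultimately show ?thesis
    by (auto simp: fundamental_group_def)
qed

lemma one_fundamental_group: "\<one>\<^bsub>fundamental_group Y (q x0)\<^esub> = deck_class \<one>"
  using loop_rel_class[OF const_deck_class] by (simp add: fundamental_group_def)

text \<open>Associativity, unit and inverses are inherited from the deck group, so no
  reparametrising homotopies enter.\<close>

lemma group_fundamental_group: "group (fundamental_group Y (q x0))"
proof (rule groupI)
  show "\<exists>B\<in>carrier (fundamental_group Y (q x0)). B \<otimes>\<^bsub>fundamental_group Y (q x0)\<^esub> A = \<one>\<^bsub>fundamental_group Y (q x0)\<^esub>"
    if A: "A \<in> carrier (fundamental_group Y (q x0))" for A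
  proof -
    obtain \<gamma> where "\<gamma> \<in> carrier \<Gamma>" "A = deck_class \<gamma>"
      using A by (auto simp: carrier_fundamental_group)
    then show ?thesis
      by (intro bexI[of _ "deck_class (inv \<gamma>)"])
        (auto simp: carrier_fundamental_group mult_deck_class one_fundamental_group)
  qed
qed (auto simp: carrier_fundamental_group mult_deck_class one_fundamental_group m_assoc)

text \<open>The formula is that of \<open>monodromy\<close> with a general covering map
  \<open>q\<close>, so for an orbit map the two coincide by definition.\<close>

definition holonomy :: "(real \<Rightarrow> 'c) set \<Rightarrow> 'a" where
  "holonomy A = (THE \<gamma>. \<gamma> \<in> carrier \<Gamma> \<and> (\<exists>p. pathin X p \<and> p 0 = x0 \<and> p 1 = \<psi> \<gamma> x0 \<and> q \<circ> p \<in> A))"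

lemma holonomy_deck_class:
  assumes "\<gamma> \<in> carrier \<Gamma>"
  shows "holonomy (deck_class \<gamma>) = \<gamma>"
  unfolding holonomy_def
proof (rule the_equality)
  obtain p where p: "is_lift (q \<circ> p) \<gamma> p"
    by (rule lift_in_deck_class[OF assms])
  show "\<gamma> \<in> carrier \<Gamma> \<and> (\<exists>p. pathin X p \<and> p 0 = x0 \<and> p 1 = \<psi> \<gamma> x0 \<and> q \<circ> p \<in> deck_class \<gamma>)"
    using is_liftD[OF p] is_lift_deck_class[OF p] by (intro conjI exI[of _ p])
next
  fix \<delta> assume *: "\<delta> \<in> carrier \<Gamma> \<and> (\<exists>p. pathin X p \<and> p 0 = x0 \<and> p 1 = \<psi> \<delta> x0 \<and> q \<circ> p \<in> deck_class \<gamma>)"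
  then have "\<exists>p. is_lift (q \<circ> p) \<delta> p \<and> q \<circ> p \<in> deck_class \<gamma>"
    by (simp add: is_lift_def)
  then obtain p where p: "is_lift (q \<circ> p) \<delta> p \<and> q \<circ> p \<in> deck_class \<gamma>" ..
  with deck_eq[OF conjunct1[OF p]] show "\<delta> = \<gamma>"
    by (simp add: deck_class_def)
qed

lemma holonomy_iso: "holonomy \<in> iso (fundamental_group Y (q x0)) \<Gamma>"
proof (rule isoI)
  show "holonomy \<in> hom (fundamental_group Y (q x0)) \<Gamma>"
    by (rule homI) (auto simp: carrier_fundamental_group mult_deck_class holonomy_deck_class)
  show "bij_betw holonomy (carrier (fundamental_group Y (q x0))) (carrier \<Gamma>)"
    unfolding carrier_fundamental_group
    by (rule bij_betw_byWitness[where f' = deck_class]) (auto simp: holonomy_deck_class)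
qed

end

text \<open>Naturality of the identification: if \<open>p\<close> lifts a loop \<open>r\<close>,
  then \<open>F \<circ> p\<close> lifts \<open>f \<circ> r\<close>, and its end point is read off
  from the value of \<open>F\<close> at the deck translate of the base point.\<close>

lemma induced_map_deck_class:
  assumes "universal_covering_action \<Gamma> X \<psi> Y q x0" "universal_covering_action \<Gamma>' X' \<psi>' Y' q' x0'"
    and F: "continuous_map X X' F" "F x0 = x0'" "\<And>x. x \<in> topspace X \<Longrightarrow> q' (F x) = f (q x)"
    and \<theta>: "\<gamma> \<in> carrier \<Gamma>" "\<theta> \<in> carrier \<Gamma>'" "F (\<psi> \<gamma> x0) = \<psi>' \<theta> x0'"
  shows "induced_map Y' (q' x0') f (universal_covering_action.deck_class \<Gamma> X \<psi> Y q x0 \<gamma>)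
    = universal_covering_action.deck_class \<Gamma>' X' \<psi>' Y' q' x0' \<theta>"
proof -
  interpret A: universal_covering_action \<Gamma> X \<psi> Y q x0 by fact
  interpret B: universal_covering_action \<Gamma>' X' \<psi>' Y' q' x0' by fact
  have "loop_rel Y' (q' x0') `` {f \<circ> r} = B.deck_class \<theta>" if r: "r \<in> A.deck_class \<gamma>" for r
  proof (rule B.loop_rel_class)
    obtain p where "A.is_lift r \<gamma> p"
      by (rule A.deck_class_lift[OF r])
    note p = A.is_liftD[OF this]
    have "p t \<in> topspace X" if "t \<in> {0..1}" for t
      using path_image_subset_topspace[OF p(2)] that by blast
    then have "B.is_lift (f \<circ> r) \<theta> (F \<circ> p)"
      using p(3-5) F(2,3) \<theta>(2,3) pathin_compose[OF p(2) F(1)] by (simp add: B.is_lift_def)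
    then show "f \<circ> r \<in> B.deck_class \<theta>"
      by (rule B.is_lift_deck_class)
  qed
  moreover have "A.deck_class \<gamma> \<noteq> {}"
    using A.deck_class_nonempty \<theta>(1) by blast
  ultimately show ?thesis
    by (auto simp: induced_map_def)
qed

section \<open>Translates of tilings\<close>

definition shift :: "'a::ab_group_add \<Rightarrow> 'l \<times> 'a set \<Rightarrow> 'l \<times> 'a set" where
  "shift v = map_prod id (image (\<lambda>x. x + v))"

definition translate :: "'a::ab_group_add \<Rightarrow> ('l \<times> 'a set) set \<Rightarrow> ('l \<times> 'a set) set" where
  "translate v = move (\<lambda>x. x + v)"

lemma move_move: "move f (move g T) = move (f \<circ> g) T"
  unfolding move_def image_image by (intro image_cong) (auto simp: image_image)

lemma move_id [simp]: "move id T = T" "move (\<lambda>x. x) T = T"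
  unfolding move_def by (auto simp: map_prod_def)

lemma translate_shift: "translate v T = shift v ` T"
  by (simp add: translate_def move_def shift_def)

lemma translate_translate [simp]: "translate v (translate w T) = translate (w + v) T"
  by (simp add: translate_def move_move o_def add.assoc)

lemma translate_zero [simp]: "translate 0 T = T"
  by (simp add: translate_def)

lemma shift_shift [simp]: "shift v (shift w t) = shift (w + v) t"
  by (cases t) (simp add: shift_def image_image add.assoc)

lemma shift_zero [simp]: "shift 0 t = t"
  by (cases t) (simp add: shift_def)

lemma shift_in_translate: "t \<in> T \<Longrightarrow> shift v t \<in> translate v T"
  unfolding translate_shift by (rule imageI)

lemma in_translate_iff: "t \<in> translate v T \<longleftrightarrow> shift (- v) t \<in> T"
  using shift_in_translate[of "shift (- v) t" T v] by (auto simp: translate_shift)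

lemma snd_shift: "snd (shift v t) = (+) v ` snd t"
  by (cases t) (simp add: shift_def add.commute)

lemma in_translation_iff [simp]: "v + x \<in> (+) v ` S \<longleftrightarrow> x \<in> S" for v :: "'a::ab_group_add"
  by auto

lemma polyhedral_body_translation:
  assumes "polyhedral_body P"
  shows "polyhedral_body ((+) v ` P)"
proof -
  obtain \<Q> where \<Q>: "finite \<Q>" "\<Q> \<noteq> {}" "\<forall>Q\<in>\<Q>. polytope Q \<and> interior Q \<noteq> {}" "P = \<Union>\<Q>"
    using assms unfolding polyhedral_body_def by (elim exE conjE)
  show ?thesis
    unfolding polyhedral_body_def
  proof (intro exI conjI)
    show "finite (image ((+) v) ` \<Q>)" "image ((+) v) ` \<Q> \<noteq> {}"
      using \<Q> by simp_all
    show "\<forall>Q\<in>image ((+) v) ` \<Q>. polytope Q \<and> interior Q \<noteq> {}"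
      using \<Q>(3) by (simp add: polytope_translation_eq interior_translation)
    show "(+) v ` P = \<Union> (image ((+) v) ` \<Q>)"
      using \<Q>(4) by blast
  qed
qed

lemma same_germ_translation:
  "same_germ ((+) v ` P) (v + x) (v + y) \<longleftrightarrow> same_germ P x y"
  unfolding same_germ_def by (simp add: add.assoc)

lemma connected_component_translation_subset:
  fixes S :: "'a::real_normed_vector set"
  shows "(+) v ` connected_component_set S x \<subseteq> connected_component_set ((+) v ` S) (v + x)"
proof
  fix z assume "z \<in> (+) v ` connected_component_set S x"
  then obtain y C where y: "z = v + y" "connected C" "C \<subseteq> S" "x \<in> C" "y \<in> C"
    unfolding connected_component_def by blast
  then have "connected ((+) v ` C)"
    by (intro connected_continuous_image continuous_intros)
  then show "z \<in> connected_component_set ((+) v ` S) (v + x)"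
    using y unfolding connected_component_def by blast
qed

lemma connected_component_translation:
  fixes S :: "'a::real_normed_vector set"
  shows "connected_component_set ((+) v ` S) (v + x) = (+) v ` connected_component_set S x"
proof (rule antisym)
  have "(+) (- v) ` connected_component_set ((+) v ` S) (v + x) \<subseteq> connected_component_set S x"
    using connected_component_translation_subset[of "- v" "(+) v ` S" "v + x"] by (simp add: image_image)
  then have "(+) v ` (+) (- v) ` connected_component_set ((+) v ` S) (v + x) \<subseteq> (+) v ` connected_component_set S x"
    by (rule image_mono)
  then show "connected_component_set ((+) v ` S) (v + x) \<subseteq> (+) v ` connected_component_set S x"
    by (simp add: image_image)
qed (rule connected_component_translation_subset)

lemma faces_translation: "faces ((+) v ` P) = image ((+) v) ` faces P"
proof -
  have "{y \<in> (+) v ` P. same_germ ((+) v ` P) (v + x) y} = (+) v ` {y \<in> P. same_germ P x y}" for x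
    by (auto simp: same_germ_translation)
  then show ?thesis
    unfolding faces_def image_image
    by (simp add: connected_component_translation closure_translation)
qed

lemma meet_face_to_face_translation:
  assumes "meet_face_to_face P Q"
  shows "meet_face_to_face ((+) v ` P) ((+) v ` Q)"
proof -
  obtain \<F> where \<F>: "\<F> \<subseteq> faces P \<inter> faces Q" "P \<inter> Q = \<Union>\<F>" and fr: "P \<inter> Q \<subseteq> frontier P \<inter> frontier Q"
    using assms unfolding meet_face_to_face_def by (elim exE conjE)
  have PQ: "(+) v ` P \<inter> (+) v ` Q = (+) v ` (P \<inter> Q)"
    by auto
  have "image ((+) v) ` \<F> \<subseteq> faces ((+) v ` P) \<inter> faces ((+) v ` Q)"
    using \<F>(1) unfolding faces_translation by blast
  moreover have "(+) v ` P \<inter> (+) v ` Q = \<Union> (image ((+) v) ` \<F>)"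
    unfolding PQ \<F>(2) by blast
  moreover have "(+) v ` P \<inter> (+) v ` Q \<subseteq> frontier ((+) v ` P) \<inter> frontier ((+) v ` Q)"
    unfolding PQ frontier_translation using fr by blast
  ultimately show ?thesis
    unfolding meet_face_to_face_def by blast
qed

lemma tiling_body: "tiling T \<Longrightarrow> t \<in> T \<Longrightarrow> polyhedral_body (snd t)"
  by (simp add: tiling_def)

lemma tiling_cover:
  assumes "tiling T"
  obtains t where "t \<in> T" "x \<in> snd t"
proof -
  have "x \<in> (\<Union>t\<in>T. snd t)"
    using assms by (simp add: tiling_def)
  with that show thesis by blast
qed

lemma tiling_meet: "tiling T \<Longrightarrow> s \<in> T \<Longrightarrow> t \<in> T \<Longrightarrow> s \<noteq> t \<Longrightarrow> meet_face_to_face (snd s) (snd t)"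
  by (simp add: tiling_def)

lemma tiling_translate:
  assumes "tiling T"
  shows "tiling (translate v T)"
  unfolding tiling_def
proof (intro conjI ballI impI)
  fix t assume "t \<in> translate v T"
  then have "polyhedral_body ((+) v ` snd (shift (- v) t))"
    unfolding in_translate_iff by (rule polyhedral_body_translation[OF tiling_body[OF assms]])
  then show "polyhedral_body (snd t)"
    by (simp add: snd_shift image_image)
next
  show "(\<Union>t\<in>translate v T. snd t) = UNIV"
  proof (rule antisym[OF subset_UNIV subsetI])
    fix x
    obtain t where "t \<in> T" "x - v \<in> snd t"
      by (rule tiling_cover[OF assms])
    then have "shift v t \<in> translate v T" "x \<in> snd (shift v t)"
      using in_translation_iff[of v "x - v" "snd t"] by (simp_all add: snd_shift shift_in_translate)
    then show "x \<in> (\<Union>t\<in>translate v T. snd t)" by blast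
  qed
next
  fix s t assume st: "s \<in> translate v T" "t \<in> translate v T" "s \<noteq> t"
  have "shift (- v) s \<noteq> shift (- v) t"
  proof
    assume "shift (- v) s = shift (- v) t"
    then have "shift v (shift (- v) s) = shift v (shift (- v) t)" by (rule arg_cong)
    with st(3) show False by simp
  qed
  then have "meet_face_to_face (snd (shift (- v) s)) (snd (shift (- v) t))"
    using st(1,2) tiling_meet[OF assms] unfolding in_translate_iff by metis
  then have "meet_face_to_face ((+) v ` snd (shift (- v) s)) ((+) v ` snd (shift (- v) t))"
    by (rule meet_face_to_face_translation)
  then show "meet_face_to_face (snd s) (snd t)"
    by (simp add: snd_shift image_image)
next
  obtain \<P> where \<P>: "finite \<P>" "\<forall>t\<in>T. \<exists>p\<in>\<P>. \<exists>w. t = shift w p"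
    using assms unfolding tiling_def shift_def by (elim exE conjE)
  show "\<exists>\<P>. finite \<P> \<and> (\<forall>t\<in>translate v T. \<exists>p\<in>\<P>. \<exists>w. t = map_prod id (image (\<lambda>x. x + w)) p)"
    unfolding shift_def[symmetric]
  \<comment> \<open>The prototiles of \<open>T\<close> serve for the translate too.\<close>
  proof (intro exI[of _ \<P>] conjI ballI \<P>(1))
    fix t assume "t \<in> translate v T"
    then obtain p w where p: "p \<in> \<P>" "shift (- v) t = shift w p"
      using \<P>(2) unfolding in_translate_iff by blast
    from p(2) have "shift v (shift (- v) t) = shift v (shift w p)" by (rule arg_cong)
    then show "\<exists>p\<in>\<P>. \<exists>w. t = shift w p"
      using p(1) by auto
  qed
qed

lemma tiling_tile:
  assumes "tiling T" "t \<in> T"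
  shows "bounded (snd t)" "interior (snd t) \<noteq> {}" "snd t \<noteq> {}"
proof -
  obtain \<Q> where \<Q>: "finite \<Q>" "\<Q> \<noteq> {}" "\<forall>Q\<in>\<Q>. polytope Q \<and> interior Q \<noteq> {}" "snd t = \<Union>\<Q>"
    using tiling_body[OF assms] unfolding polyhedral_body_def by (elim exE conjE)
  show "bounded (snd t)"
    unfolding \<Q>(4) using \<Q>(1,3) by (simp add: bounded_Union polytope_imp_bounded)
  obtain Q where Q: "Q \<in> \<Q>" using \<Q>(2) by blast
  then have "Q \<subseteq> snd t"
    unfolding \<Q>(4) by (rule Union_upper)
  then have "interior Q \<subseteq> interior (snd t)"
    by (rule interior_mono)
  moreover have "interior Q \<noteq> {}"
    using \<Q>(3) Q by blast
  ultimately show "interior (snd t) \<noteq> {}" by blast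
  then show "snd t \<noteq> {}" using interior_subset by blast
qed

lemma tiling_interior_disjoint:
  assumes "tiling T" "s \<in> T" "t \<in> T" "x \<in> interior (snd s)" "x \<in> snd t"
  shows "s = t"
proof (rule ccontr)
  assume "s \<noteq> t"
  then have "snd s \<inter> snd t \<subseteq> frontier (snd s)"
    using tiling_meet[OF assms(1-3)] unfolding meet_face_to_face_def by blast
  then show False
    using assms(4,5) interior_subset by (auto simp: frontier_def)
qed

text \<open>An interior point of a tile of \<open>T\<close> is covered by some tile of
  \<open>S\<close>, and no other tile of \<open>T\<close> contains that point.\<close>

lemma tiling_subset_imp_eq:
  assumes "tiling S" "tiling T" "S \<subseteq> T"
  shows "S = T"
proof (rule antisym[OF assms(3)], rule subsetI)
  fix t assume t: "t \<in> T"
  obtain x where x: "x \<in> interior (snd t)"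
    using tiling_tile(2)[OF assms(2) t] by blast
  obtain s where s: "s \<in> S" "x \<in> snd s"
    by (rule tiling_cover[OF assms(1)])
  then have "t = s"
    using tiling_interior_disjoint[OF assms(2) t _ x s(2)] assms(3) by blast
  with s show "t \<in> S" by simp
qed

text \<open>Otherwise the set would contain the unbounded sequence \<open>x + n v\<close>. Applied
  to the support of a tile, it shows that a tile determines its position.\<close>

lemma bounded_translation_invariant:
  fixes S :: "'a::real_normed_vector set"
  assumes "bounded S" "S \<noteq> {}" "(+) v ` S = S"
  shows "v = 0"
proof (rule ccontr)
  assume v: "v \<noteq> 0"
  obtain x where x: "x \<in> S" using assms(2) by blast
  have n: "of_nat n *\<^sub>R v + x \<in> S" for n
  proof (induction n)
    case (Suc n)
    then have "v + (of_nat n *\<^sub>R v + x) \<in> S"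
      using assms(3) by blast
    then show ?case by (simp add: algebra_simps)
  qed (use x in simp)
  obtain B where B: "\<And>y. y \<in> S \<Longrightarrow> norm y \<le> B"
    using assms(1) unfolding bounded_iff by blast
  obtain n where n': "B + norm x < of_nat n * norm v"
    using reals_Archimedean3[of "norm v"] v by auto
  have "of_nat n * norm v = norm ((of_nat n *\<^sub>R v + x) - x)" by simp
  also have "\<dots> \<le> norm (of_nat n *\<^sub>R v + x) + norm x" by (rule norm_triangle_ineq4)
  also have "\<dots> \<le> B + norm x" using B[OF n] by simp
  finally show False using n' by simp
qed

lemma periods_iff: "v \<in> periods T \<longleftrightarrow> translate v T = T"
  by (simp add: periods_def translate_def)

lemma zero_in_periods: "0 \<in> periods T"
  by (simp add: periods_iff)

lemma add_in_periods: "v \<in> periods T \<Longrightarrow> w \<in> periods T \<Longrightarrow> v + w \<in> periods T"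
  unfolding periods_iff by (metis translate_translate)

lemma minus_in_periods:
  assumes "v \<in> periods T"
  shows "- v \<in> periods T"
proof -
  have "translate (- v) (translate v T) = T" by simp
  then show ?thesis using assms unfolding periods_iff by simp
qed

lemma translate_eq_iff: "translate v T = translate w T \<longleftrightarrow> v - w \<in> periods T"
proof
  assume "translate v T = translate w T"
  then have "translate (- w) (translate v T) = translate (- w) (translate w T)" by (rule arg_cong)
  then show "v - w \<in> periods T" unfolding periods_iff by simp
next
  assume "v - w \<in> periods T"
  then have "translate w (translate (v - w) T) = translate w T" unfolding periods_iff by (rule arg_cong)
  then show "translate v T = translate w T" by simp
qed

lemma periods_translate [simp]: "periods (translate w T) = periods T"
proof -
  have "v \<in> periods (translate w T) \<longleftrightarrow> v \<in> periods T" for v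
    unfolding periods_iff[of v "translate w T"] by (simp add: translate_eq_iff)
  then show ?thesis by blast
qed

section \<open>Periodic tilings and their hull\<close>

text \<open>The lattice as the image of the integer vectors under a linear automorphism: metric
  facts about it reduce to facts about integer coordinates by norm bounds for
  \<open>A\<close>.\<close>

lemma full_rank_lattice_coordinates:
  fixes L :: "(real^'n) set"
  assumes "full_rank_lattice L"
  obtains A :: "real^'n \<Rightarrow> real^'n" where "linear A" "inj A" "L = range (\<lambda>k :: 'n \<Rightarrow> int. A (\<chi> i. of_int (k i)))"
proof -
  obtain b :: "'n \<Rightarrow> real^'n" where b: "inj b" "independent (range b)"
    "L = range (\<lambda>k :: 'n \<Rightarrow> int. \<Sum>i\<in>UNIV. of_int (k i) *\<^sub>R b i)"
    using assms unfolding full_rank_lattice_def by (elim exE conjE)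
  define A where "A = (\<lambda>c :: real^'n. \<Sum>i\<in>UNIV. c $ i *\<^sub>R b i)"
  have lin: "linear A"
    unfolding A_def by (intro linear_compose_sum ballI linearI) (simp_all add: algebra_simps)
  have "inj A"
    unfolding linear_injective_0[OF lin]
  proof (intro allI impI)
    fix c assume "A c = 0"
    \<comment> \<open>Independence speaks of the set \<open>range b\<close>, so the sum over indices
      is rewritten as a sum over basis vectors.\<close>
    moreover have "A c = (\<Sum>v\<in>range b. c $ inv_into UNIV b v *\<^sub>R v)"
      unfolding A_def using b(1) by (simp add: sum.reindex)
    ultimately have "(\<Sum>v\<in>range b. c $ inv_into UNIV b v *\<^sub>R v) = 0" by simp
    then have "c $ inv_into UNIV b v = 0" if "v \<in> range b" for v
      using that
      by (rule independentD[where u = "\<lambda>v. c $ inv_into UNIV b v", OF b(2) finite_imageI[OF finite] subset_refl])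
    then have "c $ i = 0" for i
      using b(1) by (metis inv_into_f_f UNIV_I rangeI)
    then show "c = 0" by (simp add: vec_eq_iff)
  qed
  with lin that b(3) show thesis by (simp add: A_def)
qed

lemma linear_eq_on_spanning_set:
  fixes f g :: "'a::real_vector \<Rightarrow> 'b::real_vector"
  assumes "linear f" "linear g" "\<And>x. x \<in> B \<Longrightarrow> f x = g x" "span B = UNIV"
  shows "f = g"
  using linear_eq_on_span[OF assms(1,2,3)] assms(4) by auto

locale periodic =
  fixes T :: "('l \<times> (real^'n) set) set"
  assumes periodic: "periodic_tiling T"
begin

lemma tiling: "tiling T" and lattice: "full_rank_lattice (periods T)"
  using periodic by (simp_all add: periodic_tiling_def)

lemma periods_cocompact: "\<exists>D. \<forall>x. \<exists>l\<in>periods T. norm (x + l) \<le> D"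
proof -
  obtain A :: "real^'n \<Rightarrow> real^'n" where A: "linear A" "inj A" "periods T = range (\<lambda>k :: 'n \<Rightarrow> int. A (\<chi> i. of_int (k i)))"
    by (rule full_rank_lattice_coordinates[OF lattice])
  obtain B where B: "B > 0" "\<And>x. norm (A x) \<le> B * norm x"
    using linear_bounded_pos[OF A(1)] by blast
  show ?thesis
  proof (intro exI allI)
    fix x
    obtain c where c: "x = A c"
      using linear_injective_imp_surjective[OF A(1,2)] by (metis surjD)
    \<comment> \<open>Subtracting integer parts leaves coordinates in the unit cube, whose points
      have l1-norm at most the dimension; \<open>A\<close> enlarges norms by at most
      \<open>B\<close>.\<close>
    let ?l = "A (\<chi> i. of_int (- \<lfloor>c $ i\<rfloor>))"
    have "x + ?l = A (c + (\<chi> i. of_int (- \<lfloor>c $ i\<rfloor>)))"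
      by (simp add: c linear_add[OF A(1)])
    also have "norm \<dots> \<le> B * norm (c + (\<chi> i. of_int (- \<lfloor>c $ i\<rfloor>)))"
      by (rule B(2))
    also have "\<dots> \<le> B * CARD('n)"
    proof (rule mult_left_mono)
      have "norm (c + (\<chi> i. of_int (- \<lfloor>c $ i\<rfloor>))) \<le> (\<Sum>i\<in>UNIV. \<bar>(c + (\<chi> i. of_int (- \<lfloor>c $ i\<rfloor>))) $ i\<bar>)"
        by (rule norm_le_l1_cart)
      also have "\<dots> \<le> (\<Sum>i\<in>(UNIV::'n set). 1)"
      proof (rule sum_mono)
        fix i
        have "\<bar>c $ i - of_int \<lfloor>c $ i\<rfloor>\<bar> \<le> 1"
          by linarith
        then show "\<bar>(c + (\<chi> i. of_int (- \<lfloor>c $ i\<rfloor>))) $ i\<bar> \<le> 1" by simp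
      qed
      finally show "norm (c + (\<chi> i. of_int (- \<lfloor>c $ i\<rfloor>))) \<le> CARD('n)" by simp
    qed (use B in simp)
    finally have "norm (x + ?l) \<le> B * CARD('n)" .
    moreover have "?l \<in> periods T"
      unfolding A(3) by (rule rangeI)
    ultimately show "\<exists>l\<in>periods T. norm (x + l) \<le> B * CARD('n)" by blast
  qed
qed

text \<open>The injective map \<open>A\<close> shrinks norms at most by a factor \<open>B\<close>,
  and an integer vector of norm below 1 is 0.\<close>

lemma periods_discrete: "\<exists>\<delta>>0. \<forall>l\<in>periods T. norm l < \<delta> \<longrightarrow> l = 0"
proof -
  obtain A :: "real^'n \<Rightarrow> real^'n" where A: "linear A" "inj A" "periods T = range (\<lambda>k :: 'n \<Rightarrow> int. A (\<chi> i. of_int (k i)))"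
    by (rule full_rank_lattice_coordinates[OF lattice])
  obtain B where B: "B > 0" "\<And>x. B * norm x \<le> norm (A x)"
    using linear_inj_bounded_below_pos[OF A(1,2)] by blast
  have "l = 0" if l: "l \<in> periods T" "norm l < B" for l
  proof -
    obtain k :: "'n \<Rightarrow> int" where k: "l = A (\<chi> i. of_int (k i))"
      using l(1) unfolding A(3) by blast
    have "B * norm (\<chi> i. real_of_int (k i)) < B * 1"
      using B(2)[of "\<chi> i. of_int (k i)"] l(2) unfolding k by simp
    then have "norm (\<chi> i. real_of_int (k i)) < 1"
      using B(1) by (simp only: mult_less_cancel_left_pos)
    moreover have "\<bar>real_of_int (k i)\<bar> \<le> norm (\<chi> i. real_of_int (k i))" for i
      using component_le_norm_cart[of "\<chi> i. real_of_int (k i)" i] by simp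
    ultimately have "\<bar>real_of_int (k i)\<bar> < 1" for i
      by (meson le_less_trans)
    then have "k i = 0" for i
      using of_int_less_iff[of "\<bar>k i\<bar>" 1, where 'a = real] by simp
    then have "(\<chi> i. real_of_int (k i)) = 0" by (simp add: vec_eq_iff)
    then show ?thesis using k linear_0[OF A(1)] by simp
  qed
  with B(1) show ?thesis by blast
qed

lemma periods_finite_basis: "\<exists>B. finite B \<and> B \<subseteq> periods T \<and> span B = UNIV"
proof -
  obtain A :: "real^'n \<Rightarrow> real^'n" where A: "linear A" "inj A" "periods T = range (\<lambda>k :: 'n \<Rightarrow> int. A (\<chi> i. of_int (k i)))"
    by (rule full_rank_lattice_coordinates[OF lattice])
  have "A (axis i 1) \<in> periods T" for i
  proof -
    have "(axis i 1 :: real^'n) = (\<chi> j. of_int (if j = i then 1 else 0))"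
      by (simp add: axis_def vec_eq_iff)
    then show ?thesis unfolding A(3) by (metis rangeI)
  qed
  then have "A ` Basis \<subseteq> periods T"
    by (auto simp: Basis_vec_def)
  moreover have "span (A ` Basis) = UNIV"
    using linear_injective_imp_surjective[OF A(1,2)] by (simp add: linear_span_image[OF A(1)])
  ultimately show ?thesis
    by (intro exI[of _ "A ` Basis"]) simp
qed

lemma periods_finite_ball: "finite {l \<in> periods T. norm l \<le> r}"
proof -
  obtain \<delta> where \<delta>: "\<delta> > 0" "\<forall>l\<in>periods T. norm l < \<delta> \<longrightarrow> l = 0"
    using periods_discrete by blast
  have "uniform_discrete {l \<in> periods T. norm l \<le> r}"
    unfolding uniform_discrete_def
  proof (intro exI[of _ \<delta>] conjI ballI impI \<delta>(1))
    fix x y assume "x \<in> {l \<in> periods T. norm l \<le> r}" "y \<in> {l \<in> periods T. norm l \<le> r}" "dist x y < \<delta>"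
    then have "x + - y \<in> periods T" "norm (x + - y) < \<delta>"
      using add_in_periods[OF _ minus_in_periods, of x T y] by (simp_all add: dist_norm)
    then have "x + - y = 0" using \<delta>(2) by blast
    then show "x = y" by simp
  qed
  moreover have "bounded {l \<in> periods T. norm l \<le> r}"
    by (auto simp: bounded_iff)
  ultimately show ?thesis
    using uniform_discrete_finite_iff by blast
qed

text \<open>Two positions of \<open>t\<close> in \<open>T\<close> at distance below the radius of a
  ball inside \<open>t\<close> overlap in an interior point, so they give the same tile, and a
  bounded tile is not invariant under a nonzero translation. The positions are thus uniformly
  separated, and bounded.\<close>

lemma finite_tile_translations:
  assumes "bounded (snd t)" "interior (snd t) \<noteq> {}"
  shows "finite {v. norm v \<le> D \<and> shift v t \<in> T}"
proof -
  obtain x where "x \<in> interior (snd t)" using assms by blast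
  then obtain r where r: "r > 0" "ball x r \<subseteq> snd t"
    by (auto simp: mem_interior)
  let ?V = "{v. norm v \<le> D \<and> shift v t \<in> T}"
  have "uniform_discrete ?V"
    unfolding uniform_discrete_def
  proof (intro exI[of _ r] conjI ballI impI r(1))
    fix v w assume v: "v \<in> ?V" and w: "w \<in> ?V" and d: "dist v w < r"
    have "ball (v + x) r \<subseteq> snd (shift v t)"
    proof
      fix y assume "y \<in> ball (v + x) r"
      then have "y - v \<in> snd t"
        using r(2) by (auto simp: dist_norm algebra_simps)
      then have "v + (y - v) \<in> snd (shift v t)"
        unfolding snd_shift by (rule imageI)
      then show "y \<in> snd (shift v t)" by simp
    qed
    then have "v + x \<in> interior (snd (shift v t))"
      by (rule interiorI[OF open_ball, rotated]) (use r(1) in simp)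
    moreover have "v + x \<in> snd (shift w t)"
    proof -
      have "x + (v - w) \<in> ball x r"
        using d by (simp add: dist_norm norm_minus_commute)
      then have "w + (x + (v - w)) \<in> snd (shift w t)"
        unfolding snd_shift using r(2) by blast
      then show ?thesis by (simp add: algebra_simps)
    qed
    ultimately have "shift v t = shift w t"
      using tiling_interior_disjoint[OF tiling] v w by blast
    then have "shift (- w) (shift v t) = shift (- w) (shift w t)" by (rule arg_cong)
    then have "(+) (v - w) ` snd t = snd t"
      by (metis snd_shift shift_shift shift_zero add.right_inverse diff_conv_add_uminus)
    moreover have "snd t \<noteq> {}" using assms(2) interior_subset by blast
    ultimately have "v - w = 0"
      using bounded_translation_invariant[OF assms(1)] by blast
    then show "v = w" by simp
  qed
  moreover have "bounded ?V"
    by (auto simp: bounded_iff)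
  ultimately show ?thesis
    using uniform_discrete_finite_iff by blast
qed

lemma translate_in_hull: "translate v T \<in> hull_set T"
proof -
  have "\<exists>w. move (\<lambda>x. x + w) P \<subseteq> T" if "P \<subseteq> translate v T" for P
  proof -
    have "translate (- v) P \<subseteq> translate (- v) (translate v T)"
      using that unfolding translate_shift by (rule image_mono)
    then show ?thesis unfolding translate_def[symmetric] by auto
  qed
  then show ?thesis
    unfolding hull_set_def using tiling_translate[OF tiling] by blast
qed

text \<open>A compactness argument from patches to the whole tiling. Modulo periods only finitely
  many translations carry a chosen tile \<open>t\<close> of \<open>T'\<close> into \<open>T\<close>.
  If none of them worked for all of \<open>T'\<close>, one counterexample tile for each, together
  with \<open>t\<close>, would form a finite patch fitting nowhere in \<open>T\<close>.\<close>

lemma hull_set_translate: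
  assumes "T' \<in> hull_set T"
  obtains v where "T' = translate v T"
proof -
  have T': "tiling T'" and patch: "\<And>P. finite P \<Longrightarrow> P \<subseteq> T' \<Longrightarrow> \<exists>v. translate v P \<subseteq> T"
    using assms unfolding hull_set_def translate_def by auto
  obtain t where t: "t \<in> T'" by (rule tiling_cover[OF T'])
  obtain D where D: "\<forall>x. \<exists>l\<in>periods T. norm (x + l) \<le> D"
    using periods_cocompact ..
  let ?V = "{v. norm v \<le> D \<and> shift v t \<in> T}"
  have fin: "finite ?V"
    by (rule finite_tile_translations[OF tiling_tile(1,2)[OF T' t]])
  have "\<exists>v. translate v T' \<subseteq> T"
  proof (rule ccontr)
    assume "\<nexists>v. translate v T' \<subseteq> T"
    then have "\<forall>v. \<exists>s\<in>T'. shift v s \<notin> T"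
      unfolding translate_shift by blast
    then obtain s where s: "\<And>v. s v \<in> T'" "\<And>v. shift v (s v) \<notin> T"
      by metis
    have "finite (insert t (s ` ?V))" "insert t (s ` ?V) \<subseteq> T'"
      using fin s t by auto
    then obtain v where v: "translate v (insert t (s ` ?V)) \<subseteq> T"
      using patch by blast
    \<comment> \<open>A period brings the fitting translation into the bounded range for which
      counterexamples were collected.\<close>
    obtain l where l: "l \<in> periods T" "norm (v + l) \<le> D"
      using D by blast
    have "translate l (translate v (insert t (s ` ?V))) \<subseteq> translate l T"
      using v unfolding translate_shift by (rule image_mono)
    then have "translate (v + l) (insert t (s ` ?V)) \<subseteq> T"
      using l(1) unfolding periods_iff by simp
    then have "shift (v + l) t \<in> T" and *: "shift (v + l) ` s ` ?V \<subseteq> T"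
      unfolding translate_shift by auto
    then have "v + l \<in> ?V" using l(2) by simp
    with * have "shift (v + l) (s (v + l)) \<in> T" by blast
    with s(2) show False by blast
  qed
  then obtain v where "translate v T' \<subseteq> T" ..
  then have "translate v T' = T"
    by (rule tiling_subset_imp_eq[OF tiling_translate[OF T'] tiling])
  then have "translate (- v) (translate v T') = translate (- v) T" by simp
  then show thesis using that by simp
qed

lemma hull_set_eq: "hull_set T = range (\<lambda>v. translate v T)"
  using translate_in_hull by (auto elim: hull_set_translate)

lemma periods_hull: "T' \<in> hull_set T \<Longrightarrow> periods T' = periods T"
  by (auto simp: hull_set_eq)

end

text \<open>A tile is moved by a common period until it meets the ball, compared there, and moved
  back.\<close>

lemma agree_on_ball_periodic_subset:
  assumes agree: "agree_on_ball r S T" and cover: "\<And>x. \<exists>l\<in>L. norm (x + l) < r"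
    and S: "L \<subseteq> periods S" and T: "L \<subseteq> periods T" and ne: "\<And>t. t \<in> S \<Longrightarrow> snd t \<noteq> {}"
  shows "S \<subseteq> T"
proof
  fix t assume t: "t \<in> S"
  then obtain x where "x \<in> snd t" using ne by blast
  moreover obtain l where l: "l \<in> L" "norm (x + l) < r" using cover by blast
  ultimately have "snd (shift l t) \<inter> ball 0 r \<noteq> {}"
    by (auto simp: snd_shift add.commute)
  moreover have "shift l t \<in> S"
    using shift_in_translate[OF t, of l] l(1) S unfolding periods_iff[symmetric] by (metis periods_iff subsetD)
  ultimately have "shift l t \<in> T"
    using agree unfolding agree_on_ball_def by blast
  then have "shift (- l) (shift l t) \<in> translate (- l) T"
    by (rule shift_in_translate)
  moreover have "translate (- l) T = T"
    using minus_in_periods l(1) T unfolding periods_iff[symmetric] by blast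
  ultimately show "t \<in> T" by simp
qed

lemma agree_on_ball_sym: "agree_on_ball r S T \<Longrightarrow> agree_on_ball r T S"
  by (simp add: agree_on_ball_def)

lemma agree_on_ballD:
  assumes "agree_on_ball r S T" "t \<in> S" "x \<in> snd t" "norm x < r"
  shows "t \<in> T"
proof -
  have "t \<in> {t \<in> S. snd t \<inter> ball 0 r \<noteq> {}}"
    using assms(2-4) by auto
  then show ?thesis
    using assms(1) unfolding agree_on_ball_def by blast
qed

lemma agree_on_ballI:
  assumes "\<And>t x. t \<in> S \<Longrightarrow> x \<in> snd t \<Longrightarrow> norm x < r \<Longrightarrow> t \<in> T"
    and "\<And>t x. t \<in> T \<Longrightarrow> x \<in> snd t \<Longrightarrow> norm x < r \<Longrightarrow> t \<in> S"
  shows "agree_on_ball r S T"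
  unfolding agree_on_ball_def using assms by fastforce

section \<open>The topology of the hull as that of a torus\<close>

context periodic
begin

lemma tiling_hull: "T' \<in> hull_set T \<Longrightarrow> tiling T'"
  by (simp add: hull_set_def)

lemma translate_hull: "T' \<in> hull_set T \<Longrightarrow> translate v T' \<in> hull_set T"
  by (auto simp: hull_set_eq)

lemma agree_on_ball_imp_eq:
  assumes "T1 \<in> hull_set T" "T2 \<in> hull_set T" "agree_on_ball r T1 T2"
    and "\<And>x. \<exists>l\<in>periods T. norm (x + l) < r"
  shows "T1 = T2"
proof (rule antisym)
  have per: "periods T \<subseteq> periods T1" "periods T \<subseteq> periods T2"
    using periods_hull assms(1,2) by auto
  show "T1 \<subseteq> T2"
    using tiling_tile(3)[OF tiling_hull[OF assms(1)]]
    by (rule agree_on_ball_periodic_subset[OF assms(3,4) per])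
  show "T2 \<subseteq> T1"
    using tiling_tile(3)[OF tiling_hull[OF assms(2)]]
    by (rule agree_on_ball_periodic_subset[OF agree_on_ball_sym[OF assms(3)] assms(4) per(2,1)])
qed

text \<open>A rotation carrying a member of the hull to one with which it agrees on a large ball maps short
  periods to periods; being close to the identity, it then fixes a basis of the discrete group of
  periods.\<close>

lemma agree_after_small_motion:
  "\<exists>\<epsilon>0>0. \<forall>\<epsilon> T1 T2. 0 < \<epsilon> \<and> \<epsilon> \<le> \<epsilon>0 \<and> T1 \<in> hull_set T \<and> T2 \<in> hull_set T \<and> agree_after_motion \<epsilon> T1 T2 \<longrightarrow>
     (\<exists>v. norm v < \<epsilon> \<and> T2 = translate v T1)"
proof -
  obtain D where D: "\<forall>x. \<exists>l\<in>periods T. norm (x + l) \<le> D"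
    using periods_cocompact ..
  have D0: "0 \<le> D"
    using D norm_ge_zero order_trans by blast
  obtain \<delta> where \<delta>: "\<delta> > 0" "\<forall>l\<in>periods T. norm l < \<delta> \<longrightarrow> l = 0"
    using periods_discrete by blast
  obtain B where B: "finite B" "B \<subseteq> periods T" "span B = UNIV"
    using periods_finite_basis by blast
  obtain M where M: "0 < M" "\<forall>b\<in>B. norm b \<le> M"
    using finite_imp_bounded[OF B(1)] unfolding bounded_pos by blast
  \<comment> \<open>\<open>D\<close> is a covering radius of the lattice, \<open>M\<close> bounds
    the spanning set \<open>B\<close> of periods, and \<open>\<delta>\<close> bounds nonzero periods
    from below. The first bound leaves a radius above \<open>D\<close> after the ball shrinks by
    \<open>M\<close>; the second gives \<open>\<epsilon> * M \<le> \<delta>\<close>.\<close>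
  define \<epsilon>0 where "\<epsilon>0 = min (1 / (D + M + 1)) (\<delta> / M)"
  show ?thesis
  proof (intro exI[of _ \<epsilon>0] conjI allI impI)
    show "0 < \<epsilon>0"
      using D0 M(1) \<delta>(1) by (simp add: \<epsilon>0_def)
    fix \<epsilon> T1 T2
    assume *: "0 < \<epsilon> \<and> \<epsilon> \<le> \<epsilon>0 \<and> T1 \<in> hull_set T \<and> T2 \<in> hull_set T \<and> agree_after_motion \<epsilon> T1 T2"
    then have \<epsilon>: "0 < \<epsilon>" "\<epsilon> \<le> 1 / (D + M + 1)" "\<epsilon> \<le> \<delta> / M" and T1: "T1 \<in> hull_set T" and T2: "T2 \<in> hull_set T"
      by (auto simp: \<epsilon>0_def)
    obtain v g where v: "norm v < \<epsilon>" and g: "orthogonal_transformation g" "onorm (\<lambda>x. g x - x) < \<epsilon>"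
      and agree: "agree_on_ball (1 / \<epsilon>) (move g (translate v T1)) T2"
      using * unfolding agree_after_motion_def translate_def by (elim exE conjE)
    have R: "D + M + 1 \<le> 1 / \<epsilon>"
      using \<epsilon>(1,2) D0 M(1) by (simp add: field_simps)
    have lin: "linear g"
      by (rule orthogonal_transformation_linear[OF g(1)])
    let ?S = "move g (translate v T1)"
    have fixed: "g b = b" if b: "b \<in> B" for b
    proof -
      have bL: "b \<in> periods T" and bM: "norm b \<le> M" using b B(2) M(2) by auto
      then have "translate b (translate v T1) = translate v T1"
        using periods_hull[OF T1] periods_iff[of b "translate v T1"] by simp
      then have "move g (translate b (translate v T1)) = ?S" by (rule arg_cong)
      moreover have "move g (translate b (translate v T1)) = translate (g b) ?S"
        unfolding translate_def by (simp add: move_move o_def linear_add[OF lin])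
      ultimately have S: "translate (g b) ?S = ?S" by simp
      have S': "shift (g b) t \<in> ?S \<longleftrightarrow> t \<in> ?S" "shift (- g b) t \<in> ?S \<longleftrightarrow> t \<in> ?S" for t
        using in_translate_iff[of "shift (g b) t" "g b" ?S] in_translate_iff[of t "g b" ?S] unfolding S by simp_all
      have gM: "norm (g b) \<le> M"
        using bM orthogonal_transformation_norm[OF g(1)] by simp
      \<comment> \<open>The rotated tiling \<open>?S\<close> has \<open>g b\<close> as a period, and
        \<open>T2\<close> agrees with \<open>?S\<close> on the ball of radius
        \<open>1 / \<epsilon>\<close>. A shift by \<open>g b\<close> costs at most \<open>M\<close>,
        so \<open>T2\<close> and its shift agree on the smaller ball, which already determines a
        tiling of the hull.\<close>
      have "translate (g b) T2 = T2"
      proof (rule agree_on_ball_imp_eq[OF translate_hull[OF T2] T2])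
        show "\<exists>l\<in>periods T. norm (x + l) < 1 / \<epsilon> - M" for x
        proof -
          obtain l where "l \<in> periods T" "norm (x + l) \<le> D" using D by blast
          moreover have "D < 1 / \<epsilon> - M" using R by simp
          ultimately show ?thesis by (meson le_less_trans)
        qed
        show "agree_on_ball (1 / \<epsilon> - M) (translate (g b) T2) T2"
        proof (rule agree_on_ballI)
          fix t x assume t: "t \<in> translate (g b) T2" "x \<in> snd t" "norm x < 1 / \<epsilon> - M"
          have "- g b + x \<in> snd (shift (- g b) t)"
            unfolding snd_shift using t(2) by (rule imageI)
          moreover have "norm (- g b + x) < 1 / \<epsilon>"
            using norm_triangle_ineq[of "- g b" x] t(3) gM by simp
          ultimately have "shift (- g b) t \<in> ?S"
            using t(1) unfolding in_translate_iff by (intro agree_on_ballD[OF agree_on_ball_sym[OF agree]])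
          then have "t \<in> ?S" using S' by simp
          moreover have "norm x < 1 / \<epsilon>" using t(3) M(1) by simp
          ultimately show "t \<in> T2"
            using t(2) by (intro agree_on_ballD[OF agree])
        next
          fix t x assume t: "t \<in> T2" "x \<in> snd t" "norm x < 1 / \<epsilon> - M"
          have "norm x < 1 / \<epsilon>" using t(3) M(1) by simp
          then have "t \<in> ?S"
            using t(1,2) by (intro agree_on_ballD[OF agree_on_ball_sym[OF agree]])
          then have "shift (- g b) t \<in> ?S" using S' by simp
          moreover have "- g b + x \<in> snd (shift (- g b) t)"
            unfolding snd_shift using t(2) by (rule imageI)
          moreover have "norm (- g b + x) < 1 / \<epsilon>"
            using norm_triangle_ineq[of "- g b" x] t(3) gM by simp
          ultimately show "t \<in> translate (g b) T2"
            unfolding in_translate_iff by (intro agree_on_ballD[OF agree])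
        qed
      qed
      then have "g b \<in> periods T"
        using periods_hull[OF T2] periods_iff by blast
      then have "g b - b \<in> periods T"
        using add_in_periods minus_in_periods[OF bL] by fastforce
      moreover have "norm (g b - b) < \<delta>"
      proof -
        have "bounded_linear (\<lambda>x. g x - x)"
          using lin by (intro bounded_linear_sub bounded_linear_ident) (simp add: linear_conv_bounded_linear)
        then have "norm (g b - b) \<le> onorm (\<lambda>x. g x - x) * norm b"
          by (rule onorm)
        also have "\<dots> \<le> onorm (\<lambda>x. g x - x) * M"
          using bM \<open>bounded_linear (\<lambda>x. g x - x)\<close> by (intro mult_left_mono onorm_pos_le)
        also have "\<dots> < \<epsilon> * M"
          using g(2) M(1) by (rule mult_strict_right_mono)
        also have "\<dots> \<le> \<delta>"
          using \<epsilon>(3) M(1) by (simp add: field_simps)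
        finally show ?thesis .
      qed
      ultimately have "g b - b = 0" using \<delta>(2) by blast
      then show ?thesis by simp
    qed
    have "g = (\<lambda>x. x)"
      by (rule linear_eq_on_spanning_set[OF lin linear_id[unfolded id_def] fixed B(3)])
    then have "agree_on_ball (1 / \<epsilon>) (translate v T1) T2"
      using agree by simp
    then have "translate v T1 = T2"
    proof (rule agree_on_ball_imp_eq[OF translate_hull[OF T1] T2])
      fix x
      obtain l where "l \<in> periods T" "norm (x + l) \<le> D" using D by blast
      moreover have "D < 1 / \<epsilon>" using R M(1) by simp
      ultimately show "\<exists>l\<in>periods T. norm (x + l) < 1 / \<epsilon>" by (meson le_less_trans)
    qed
    with v show "\<exists>v. norm v < \<epsilon> \<and> T2 = translate v T1" by blast
  qed
qed

lemma close_tilings_translate: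
  assumes "norm v < \<epsilon>"
  shows "close_tilings \<epsilon> T1 (translate v T1)"
proof -
  have "0 < \<epsilon>" using assms norm_ge_zero le_less_trans by blast
  then have "agree_after_motion \<epsilon> T1 (translate v T1)"
    unfolding agree_after_motion_def
    by (intro exI[of _ v] exI[of _ "\<lambda>x. x"])
      (use assms in \<open>simp add: translate_def agree_on_ball_def onorm_zero matrix_id_mat_1[unfolded id_def]\<close>)
  then show ?thesis by (simp add: close_tilings_def)
qed

text \<open>For small \<open>\<epsilon>\<close> closeness amounts to a translation of norm below
  \<open>\<epsilon>\<close>, rotations being excluded. The case with the roles of the two tilings
  exchanged is settled by negating the translation.\<close>

lemma openin_transl_hull_iff:
  "openin (transl_hull T) U \<longleftrightarrow> U \<subseteq> hull_set T \<and> (\<forall>T1\<in>U. \<exists>\<epsilon>>0. \<forall>v. norm v < \<epsilon> \<longrightarrow> translate v T1 \<in> U)"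
proof -
  obtain \<epsilon>0 where \<epsilon>0: "\<epsilon>0 > 0"
    "\<And>\<epsilon> T1 T2. 0 < \<epsilon> \<Longrightarrow> \<epsilon> \<le> \<epsilon>0 \<Longrightarrow> T1 \<in> hull_set T \<Longrightarrow> T2 \<in> hull_set T \<Longrightarrow> agree_after_motion \<epsilon> T1 T2 \<Longrightarrow>
      \<exists>v. norm v < \<epsilon> \<and> T2 = translate v T1"
    using agree_after_small_motion by metis
  have "(\<exists>\<epsilon>>0. \<forall>T2\<in>hull_set T. close_tilings \<epsilon> T1 T2 \<longrightarrow> T2 \<in> U) \<longleftrightarrow>
        (\<exists>\<epsilon>>0. \<forall>v. norm v < \<epsilon> \<longrightarrow> translate v T1 \<in> U)" (is "?A \<longleftrightarrow> ?B") if T1: "T1 \<in> hull_set T" for T1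
  proof
    assume ?A
    then show ?B
      using close_tilings_translate translate_hull[OF T1] by metis
  next
    assume ?B
    then obtain \<epsilon> where \<epsilon>: "\<epsilon> > 0" "\<And>v. norm v < \<epsilon> \<Longrightarrow> translate v T1 \<in> U" by metis
    have "T2 \<in> U" if T2: "T2 \<in> hull_set T" and close: "close_tilings (min \<epsilon> \<epsilon>0) T1 T2" for T2
    proof -
      have m: "0 < min \<epsilon> \<epsilon>0" "min \<epsilon> \<epsilon>0 \<le> \<epsilon>0" using \<epsilon>(1) \<epsilon>0(1) by auto
      consider "agree_after_motion (min \<epsilon> \<epsilon>0) T1 T2" | "agree_after_motion (min \<epsilon> \<epsilon>0) T2 T1"
        using close unfolding close_tilings_def by blast
      then have "\<exists>v. norm v < min \<epsilon> \<epsilon>0 \<and> T2 = translate v T1"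
      proof cases
        case 1
        then show ?thesis by (rule \<epsilon>0(2)[OF m T1 T2])
      next
        case 2
        then obtain v where "norm v < min \<epsilon> \<epsilon>0" "T1 = translate v T2"
          using \<epsilon>0(2)[OF m T2 T1] by blast
        then show ?thesis by (intro exI[of _ "- v"]) simp
      qed
      then show ?thesis using \<epsilon>(2) by auto
    qed
    then show ?A using \<epsilon>(1) \<epsilon>0(1) by (intro exI[of _ "min \<epsilon> \<epsilon>0"]) auto
  qed
  then show ?thesis
    unfolding openin_transl_hull by blast
qed

text \<open>With this sign, an element \<open>f\<close> of the space group acts on points in the same way as its
  rotational part acts on the hull.\<close>

definition hull_point :: "real^'n \<Rightarrow> ('l \<times> (real^'n) set) set" where
  "hull_point y = translate (- y) T"

lemma translate_hull_point: "translate v (hull_point y) = hull_point (y - v)"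
  by (simp add: hull_point_def)

lemma hull_point_eq_iff: "hull_point y = hull_point z \<longleftrightarrow> z - y \<in> periods T"
  by (simp add: hull_point_def translate_eq_iff)

lemma range_hull_point: "range hull_point = hull_set T"
proof (rule antisym)
  show "range hull_point \<subseteq> hull_set T"
    unfolding hull_point_def using translate_in_hull by blast
  show "hull_set T \<subseteq> range hull_point"
  proof
    fix T' assume "T' \<in> hull_set T"
    then obtain v where "T' = translate v T" by (rule hull_set_translate)
    then have "T' = hull_point (- v)" by (simp add: hull_point_def)
    then show "T' \<in> range hull_point" by (rule range_eqI)
  qed
qed

lemma continuous_hull_point: "continuous_map euclidean (transl_hull T) hull_point"
  unfolding continuous_map_def
proof (intro conjI allI impI)
  show "hull_point \<in> topspace euclidean \<rightarrow> topspace (transl_hull T)"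
    using range_hull_point by auto
  fix U assume U: "openin (transl_hull T) U"
  have "\<exists>e>0. \<forall>y'. dist y' y < e \<longrightarrow> hull_point y' \<in> U" if y: "hull_point y \<in> U" for y
  proof -
    obtain \<epsilon> where \<epsilon>: "\<epsilon> > 0" "\<And>v. norm v < \<epsilon> \<Longrightarrow> translate v (hull_point y) \<in> U"
      using U y unfolding openin_transl_hull_iff by metis
    have "hull_point y' \<in> U" if "dist y' y < \<epsilon>" for y'
      using \<epsilon>(2)[of "y - y'"] that by (simp add: translate_hull_point dist_norm norm_minus_commute)
    with \<epsilon>(1) show ?thesis by blast
  qed
  then show "openin euclidean {y \<in> topspace euclidean. hull_point y \<in> U}"
    by (simp add: open_dist)
qed

lemma open_hull_point: "open_map euclidean (transl_hull T) hull_point"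
  unfolding open_map_def
proof (intro allI impI)
  fix W :: "(real^'n) set" assume "openin euclidean W"
  then have W: "open W" by simp
  show "openin (transl_hull T) (hull_point ` W)"
    unfolding openin_transl_hull_iff
  proof (intro conjI ballI)
    show "hull_point ` W \<subseteq> hull_set T"
      using range_hull_point by blast
    fix T1 assume "T1 \<in> hull_point ` W"
    then obtain y where y: "y \<in> W" "T1 = hull_point y" by blast
    then obtain e where e: "e > 0" "\<forall>y'. dist y' y < e \<longrightarrow> y' \<in> W"
      using W unfolding open_dist by blast
    show "\<exists>\<epsilon>>0. \<forall>v. norm v < \<epsilon> \<longrightarrow> translate v T1 \<in> hull_point ` W"
      unfolding y(2) translate_hull_point
      using e by (intro exI[of _ e]) (auto simp: dist_norm)
  qed
qed

end

section \<open>Space groups and point groups\<close>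

lemma comp_group_simps [simp]:
  "carrier (comp_group S) = S" "f \<otimes>\<^bsub>comp_group S\<^esub> g = f \<circ> g" "\<one>\<^bsub>comp_group S\<^esub> = id"
  by (simp_all add: comp_group_def)

lemma group_comp_group:
  assumes "id \<in> S" "\<And>f g. f \<in> S \<Longrightarrow> g \<in> S \<Longrightarrow> f \<circ> g \<in> S" "\<And>f. f \<in> S \<Longrightarrow> \<exists>g\<in>S. g \<circ> f = id"
  shows "group (comp_group S)"
  by (rule groupI) (use assms in \<open>simp_all add: o_assoc\<close>)

lemma rot_part_apply: "f x = rot_part f x + f 0"
  by (simp add: rot_part_def)

lemma rot_part_translation [simp]: "rot_part (\<lambda>x. x + v) = id"
  by (simp add: rot_part_def fun_eq_iff)

context
  fixes f :: "real^'n \<Rightarrow> real^'n"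
  assumes f: "orientation_preserving_isometry f"
begin

lemma orthogonal_rot_part: "orthogonal_transformation (rot_part f)"
  using f unfolding orthogonal_transformation_isometry orientation_preserving_isometry_def
  by (simp add: rot_part_def dist_norm)

lemma linear_rot_part: "linear (rot_part f)"
  by (rule orthogonal_transformation_linear[OF orthogonal_rot_part])

lemma isometry_add: "f (x + y) = f x + rot_part f y"
  using rot_part_apply[of f "x + y"] rot_part_apply[of f x] linear_add[OF linear_rot_part] by simp

lemma rot_part_comp: "rot_part (f \<circ> h) = rot_part f \<circ> rot_part h"
proof
  fix x
  have "f (h x) = f (h 0 + rot_part h x)"
    using rot_part_apply[of h x] by (simp add: add.commute)
  then show "rot_part (f \<circ> h) x = (rot_part f \<circ> rot_part h) x"
    unfolding isometry_add by (simp add: rot_part_def[of "f \<circ> h"])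
qed

lemma orientation_preserving_isometry_comp:
  assumes h: "orientation_preserving_isometry h"
  shows "orientation_preserving_isometry (f \<circ> h)"
proof -
  have "linear (rot_part h)"
    using h orthogonal_transformation_linear
    unfolding orientation_preserving_isometry_def
    by (simp add: orthogonal_transformation_isometry rot_part_def dist_norm isometry_linear)
  then have "det (matrix (rot_part (f \<circ> h))) = det (matrix (rot_part f)) * det (matrix (rot_part h))"
    using matrix_compose[OF _ linear_rot_part, of "rot_part h"] by (simp add: rot_part_comp det_mul)
  then show ?thesis
    using f h unfolding orientation_preserving_isometry_def by simp
qed

lemma orientation_preserving_isometry_inverse:
  "\<exists>h. orientation_preserving_isometry h \<and> h \<circ> f = id \<and> f \<circ> h = id"
proof -
  define g where "g = inv_into UNIV (rot_part f)"
  \<comment> \<open>Solving \<open>f x = y\<close> in the form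
    \<open>rot_part f x = y - f 0\<close>.\<close>
  define h where "h = (\<lambda>y. g (y - f 0))"
  have bij: "bij (rot_part f)"
    by (rule orthogonal_transformation_bij[OF orthogonal_rot_part])
  have hf: "h (f x) = x" for x
  proof -
    have "h (f x) = g (rot_part f x)"
      by (simp add: h_def rot_part_def)
    then show ?thesis
      unfolding g_def by (simp only: inv_into_f_f[OF bij_is_inj[OF bij] UNIV_I])
  qed
  have fh: "f (h y) = y" for y
    using rot_part_apply[of f "h y"] surj_f_inv_f[OF bij_is_surj[OF bij]] unfolding h_def g_def by simp
  have "dist (h x) (h y) = dist x y" for x y
    using f unfolding orientation_preserving_isometry_def by (metis fh)
  moreover have "det (matrix (rot_part h)) > 0"
  proof -
    have "orthogonal_transformation (rot_part h)"
      using \<open>\<And>x y. dist (h x) (h y) = dist x y\<close>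
      by (simp add: orthogonal_transformation_isometry rot_part_def dist_norm)
    then have "linear (rot_part h)"
      by (rule orthogonal_transformation_linear)
    then have "det (matrix (rot_part f \<circ> rot_part h)) = det (matrix (rot_part f)) * det (matrix (rot_part h))"
      using matrix_compose[OF _ linear_rot_part, of "rot_part h"] by (simp add: det_mul)
    moreover have "rot_part f \<circ> rot_part h = id"
      unfolding rot_part_comp[symmetric] by (simp add: rot_part_def fun_eq_iff fh)
    ultimately have "det (matrix (rot_part f)) * det (matrix (rot_part h)) = 1"
      by simp
    moreover have "det (matrix (rot_part f)) > 0"
      using f unfolding orientation_preserving_isometry_def by simp
    ultimately show ?thesis
      by (metis zero_less_mult_pos zero_less_one)
  qed
  ultimately show ?thesis
    unfolding orientation_preserving_isometry_def
    by (intro exI[of _ h]) (simp add: fun_eq_iff hf fh)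
qed

end

lemma orientation_preserving_isometry_translation: "orientation_preserving_isometry (\<lambda>x. x + v)"
  by (simp add: orientation_preserving_isometry_def)

lemma in_space_group: "f \<in> carrier (space_group T) \<longleftrightarrow> orientation_preserving_isometry f \<and> move f T = T"
  by (simp add: space_group_def)

lemma space_group_simps [simp]:
  "f \<otimes>\<^bsub>space_group T\<^esub> g = f \<circ> g" "\<one>\<^bsub>space_group T\<^esub> = id"
  by (simp_all add: space_group_def)

lemma point_group_simps [simp]:
  "carrier (point_group T) = rot_part ` carrier (space_group T)"
  "f \<otimes>\<^bsub>point_group T\<^esub> g = f \<circ> g" "\<one>\<^bsub>point_group T\<^esub> = id"
  by (simp_all add: point_group_def)

lemma translation_group_simps [simp]:
  "carrier (translation_group T) = (\<lambda>v x. x + v) ` periods T"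
  "f \<otimes>\<^bsub>translation_group T\<^esub> g = f \<circ> g" "\<one>\<^bsub>translation_group T\<^esub> = id"
  by (simp_all add: translation_group_def)

lemma translation_in_space_group: "v \<in> periods T \<Longrightarrow> (\<lambda>x. x + v) \<in> carrier (space_group T)"
  by (simp add: in_space_group orientation_preserving_isometry_translation periods_def)

lemma space_group_comp:
  assumes "f \<in> carrier (space_group T)" "g \<in> carrier (space_group T)"
  shows "f \<circ> g \<in> carrier (space_group T)"
proof -
  have "move (f \<circ> g) T = T"
    using assms by (simp add: in_space_group flip: move_move)
  then show ?thesis
    using assms orientation_preserving_isometry_comp[of f g] by (simp add: in_space_group)
qed

lemma id_in_space_group: "id \<in> carrier (space_group T)"
  using translation_in_space_group[OF zero_in_periods] by (simp add: id_def)

lemma space_group_inverse: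
  assumes "f \<in> carrier (space_group T)"
  shows "\<exists>g\<in>carrier (space_group T). g \<circ> f = id"
proof -
  obtain h where h: "orientation_preserving_isometry h" "h \<circ> f = id" "f \<circ> h = id"
    using orientation_preserving_isometry_inverse assms unfolding in_space_group by metis
  have "move h (move f T) = T"
    by (simp add: move_move h)
  then have "h \<in> carrier (space_group T)"
    using assms h(1) by (simp add: in_space_group)
  with h(2) show ?thesis by (rule bexI)
qed

lemma group_space_group: "group (space_group T)"
  using group_comp_group[OF id_in_space_group space_group_comp space_group_inverse]
  by (simp add: space_group_def)

lemma rot_part_space_group_comp:
  "f \<in> carrier (space_group T) \<Longrightarrow> rot_part (f \<circ> g) = rot_part f \<circ> rot_part g"
  by (rule rot_part_comp) (simp add: in_space_group)

lemma rot_part_id [simp]: "rot_part id = id"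
  by (simp add: rot_part_def fun_eq_iff)

lemma group_point_group: "group (point_group T)"
  unfolding point_group_def
proof (rule group_comp_group)
  show "id \<in> rot_part ` carrier (space_group T)"
    using id_in_space_group by (rule image_eqI[rotated]) simp
next
  fix f g assume "f \<in> rot_part ` carrier (space_group T)" "g \<in> rot_part ` carrier (space_group T)"
  then obtain f' g' where "f' \<in> carrier (space_group T)" "g' \<in> carrier (space_group T)"
    "f = rot_part f'" "g = rot_part g'" by (elim imageE)
  then show "f \<circ> g \<in> rot_part ` carrier (space_group T)"
    using space_group_comp rot_part_space_group_comp by (metis imageI)
next
  fix f assume "f \<in> rot_part ` carrier (space_group T)"
  then obtain f' where f': "f' \<in> carrier (space_group T)" "f = rot_part f'" by (elim imageE)
  then obtain g where g: "g \<in> carrier (space_group T)" "g \<circ> f' = id"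
    using space_group_inverse by blast
  then have "rot_part g \<circ> f = id"
    using rot_part_space_group_comp[OF g(1), of f'] f'(2) by simp
  with g(1) show "\<exists>g\<in>rot_part ` carrier (space_group T). g \<circ> f = id" by blast
qed

lemma group_translation_group: "group (translation_group T)"
  unfolding translation_group_def
proof (rule group_comp_group)
  show "id \<in> (\<lambda>v x. x + v) ` periods T"
    using zero_in_periods by (rule image_eqI[rotated]) (simp add: fun_eq_iff)
next
  fix f g assume "f \<in> (\<lambda>v x. x + v) ` periods T" "g \<in> (\<lambda>v x. x + v) ` periods T"
  then obtain v w where "v \<in> periods T" "w \<in> periods T" "f = (\<lambda>x. x + v)" "g = (\<lambda>x. x + w)" by (elim imageE)
  then show "f \<circ> g \<in> (\<lambda>v x. x + v) ` periods T"
    by (intro image_eqI[OF _ add_in_periods[of w T v]]) (simp_all add: fun_eq_iff add.assoc)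
next
  fix f assume "f \<in> (\<lambda>v x. x + v) ` periods T"
  then obtain v where "v \<in> periods T" "f = (\<lambda>x. x + v)" by (elim imageE)
  then show "\<exists>g\<in>(\<lambda>v x. x + v) ` periods T. g \<circ> f = id"
    by (intro bexI[OF _ imageI[OF minus_in_periods[of v T]]]) (simp_all add: fun_eq_iff)
qed

text \<open>Such an isometry is translation by \<open>f 0\<close>, which is then a period.\<close>

lemma space_group_rot_part_id:
  assumes "f \<in> carrier (space_group T)" "rot_part f = id"
  shows "f \<in> carrier (translation_group T)"
proof -
  have f: "f = (\<lambda>x. x + f 0)"
  proof
    show "f x = x + f 0" for x
      using rot_part_apply[of f x] by (simp only: assms(2) id_apply)
  qed
  have "translate (f 0) T = move f T"
    unfolding translate_def f[symmetric] ..
  then have "f 0 \<in> periods T"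
    using assms(1) by (simp add: periods_iff in_space_group)
  then have "(\<lambda>x. x + f 0) \<in> (\<lambda>v x. x + v) ` periods T"
    by (rule imageI)
  then show ?thesis
    by (simp add: f[symmetric])
qed

lemma standard_extension:
  "group_extension (translation_group T) (space_group T) (point_group T) id rot_part"
  unfolding group_extension_def
proof (intro conjI group_translation_group group_space_group group_point_group)
  show "id \<in> mon (translation_group T) (space_group T)"
    unfolding mon_def using translation_in_space_group by (auto intro!: homI)
  show "rot_part \<in> epi (space_group T) (point_group T)"
    unfolding epi_def by (auto intro!: homI simp: rot_part_space_group_comp)
  show "kernel (space_group T) (point_group T) rot_part = id ` carrier (translation_group T)"
  proof (rule antisym)
    show "kernel (space_group T) (point_group T) rot_part \<subseteq> id ` carrier (translation_group T)"
    proof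
      fix f assume "f \<in> kernel (space_group T) (point_group T) rot_part"
      then have "f \<in> carrier (space_group T)" "rot_part f = id"
        by (simp_all add: kernel_def)
      then show "f \<in> id ` carrier (translation_group T)"
        using space_group_rot_part_id[of f T] by simp
    qed
    show "id ` carrier (translation_group T) \<subseteq> kernel (space_group T) (point_group T) rot_part"
      using translation_in_space_group by (auto simp: kernel_def)
  qed
qed

text \<open>Conjugating translation by \<open>v\<close> with \<open>f\<close> gives translation by
  \<open>rot_part f v\<close>.\<close>

lemma rot_part_periods:
  assumes "f \<in> carrier (space_group T)" "v \<in> periods T"
  shows "rot_part f v \<in> periods T"
proof -
  have f: "orientation_preserving_isometry f" "move f T = T"
    using assms(1) by (simp_all add: in_space_group)
  have "(\<lambda>x. x + rot_part f v) \<circ> f = f \<circ> (\<lambda>x. x + v)"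
    by (simp add: fun_eq_iff isometry_add[OF f(1)])
  then have "translate (rot_part f v) (move f T) = move f (translate v T)"
    by (simp only: translate_def move_move)
  then show ?thesis
    using assms(2) f(2) by (simp add: periods_iff)
qed

context periodic
begin

text \<open>A rotation in the group is linear and sends a finite spanning set of periods to periods
  of the same norms. Only finitely many periods have bounded norm, so only finitely many
  restrictions to that set exist, and each determines the rotation.\<close>

lemma finite_point_group: "finite (carrier (point_group T))"
proof -
  obtain B where B: "finite B" "B \<subseteq> periods T" "span B = UNIV"
    using periods_finite_basis by blast
  obtain M where M: "\<forall>b\<in>B. norm b \<le> M"
    using finite_imp_bounded[OF B(1)] unfolding bounded_iff by blast
  have *: "linear g \<and> (\<forall>b\<in>B. g b \<in> {l \<in> periods T. norm l \<le> M})" if g: "g \<in> carrier (point_group T)" for g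
  proof -
    obtain f where f: "f \<in> carrier (space_group T)" "g = rot_part f"
      using g by auto
    then have o: "orthogonal_transformation g"
      using orthogonal_rot_part[of f] by (simp add: in_space_group)
    show ?thesis
      using f rot_part_periods[OF f(1)] B(2) M orthogonal_transformation_linear[OF o] orthogonal_transformation_norm[OF o]
      by (simp add: subset_iff)
  qed
  have "inj_on (\<lambda>g. restrict g B) (carrier (point_group T))"
  proof (rule inj_onI)
    fix g h assume g: "g \<in> carrier (point_group T)" and h: "h \<in> carrier (point_group T)"
      and eq: "restrict g B = restrict h B"
    have "g b = h b" if "b \<in> B" for b
      using fun_cong[OF eq, of b] that by simp
    then show "g = h"
      using *[OF g] *[OF h] B(3) by (intro linear_eq_on_spanning_set[of g h B]) auto
  qed
  moreover have "(\<lambda>g. restrict g B) ` carrier (point_group T) \<subseteq> PiE B (\<lambda>_. {l \<in> periods T. norm l \<le> M})"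
    using * by (intro image_subsetI) (simp add: restrict_PiE_iff)
  then have "finite ((\<lambda>g. restrict g B) ` carrier (point_group T))"
    using finite_PiE[OF B(1) periods_finite_ball] by (rule finite_subset)
  ultimately show ?thesis
    by (rule finite_imageD[rotated])
qed

lemma translation_group_iso: "translation_group T \<cong> Z_power TYPE('n)"
proof -
  obtain A :: "real^'n \<Rightarrow> real^'n" where A: "linear A" "inj A" "periods T = range (\<lambda>k :: 'n \<Rightarrow> int. A (\<chi> i. of_int (k i)))"
    by (rule full_rank_lattice_coordinates[OF lattice])
  let ?h = "\<lambda>k :: 'n \<Rightarrow> int. (\<lambda>x. x + A (\<chi> i. of_int (k i)))"
  have Z: "group (Z_power TYPE('n))"
    unfolding Z_power_def by (intro product_group group_integer_group)
  have "?h \<in> iso (Z_power TYPE('n)) (translation_group T)"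
  proof (rule isoI)
    show "?h \<in> hom (Z_power TYPE('n)) (translation_group T)"
    proof (rule homI)
      fix k l :: "'n \<Rightarrow> int"
      have "A (\<chi> i. of_int (k i + l i)) = A ((\<chi> i. of_int (k i)) + (\<chi> i. of_int (l i)))"
        by (rule arg_cong[of _ _ A]) (simp add: vec_eq_iff)
      then have "A (\<chi> i. of_int (k i + l i)) = A (\<chi> i. of_int (k i)) + A (\<chi> i. of_int (l i))"
        by (simp add: linear_add[OF A(1)])
      then show "?h (k \<otimes>\<^bsub>Z_power TYPE('n)\<^esub> l) = ?h k \<otimes>\<^bsub>translation_group T\<^esub> ?h l"
        by (simp add: Z_power_def fun_eq_iff)
    qed (simp add: A(3))
    show "bij_betw ?h (carrier (Z_power TYPE('n))) (carrier (translation_group T))"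
    proof (rule bij_betw_imageI)
      show "inj_on ?h (carrier (Z_power TYPE('n)))"
      proof (rule inj_onI)
        fix k l assume "?h k = ?h l"
        then have "A (\<chi> i. of_int (k i)) = A (\<chi> i. of_int (l i))"
          by (metis add_left_cancel)
        then have "(\<chi> i. real_of_int (k i)) = (\<chi> i. of_int (l i))"
          using A(2) by (simp only: inj_eq)
        then show "k = l" by (simp add: vec_eq_iff fun_eq_iff)
      qed
      show "?h ` carrier (Z_power TYPE('n)) = carrier (translation_group T)"
        by (simp add: Z_power_def A(3) image_image)
    qed
  qed
  then show ?thesis
    using group.iso_sym[OF Z is_isoI] by blast
qed

end

text \<open>\<open>\<alpha>\<close> and \<open>\<beta>\<close> turn \<open>i'\<close> and
  \<open>p'\<close> into \<open>i\<close> and \<open>p\<close>. That \<open>i'\<close> is a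
  homomorphism is not assumed but recovered: the identity holds after applying
  \<open>\<beta>\<close>, which is injective.\<close>

lemma group_extension_transport:
  assumes ext: "group_extension N E Q i p" and \<alpha>: "\<alpha> \<in> iso N' N" and \<beta>: "\<beta> \<in> iso E' E"
    and "group N'" "group E'"
    and i': "\<And>c. c \<in> carrier N' \<Longrightarrow> i' c \<in> carrier E' \<and> \<beta> (i' c) = i (\<alpha> c)"
    and p': "\<And>c. c \<in> carrier E' \<Longrightarrow> p' c = p (\<beta> c)"
  shows "group_extension N' E' Q i' p'"
proof -
  interpret N': group N' by fact
  interpret E': group E' by fact
  have \<alpha>': "\<alpha> \<in> hom N' N" "inj_on \<alpha> (carrier N')" "\<alpha> ` carrier N' = carrier N"
    and \<beta>': "\<beta> \<in> hom E' E" "inj_on \<beta> (carrier E')" "\<beta> ` carrier E' = carrier E"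
    using \<alpha> \<beta> by (auto simp: iso_def bij_betw_def)
  have i: "i \<in> hom N E" "inj_on i (carrier N)" and p: "p \<in> hom E Q" "p ` carrier E = carrier Q"
    and ker: "kernel E Q p = i ` carrier N"
    using ext by (auto simp: group_extension_def mon_def epi_def)
  have \<alpha>c: "\<alpha> c \<in> carrier N" if "c \<in> carrier N'" for c
    using that \<alpha>'(3) by blast
  have \<beta>c: "\<beta> c \<in> carrier E" if "c \<in> carrier E'" for c
    using that \<beta>'(3) by blast
  have "i' \<in> hom N' E'"
  proof (rule homI)
    fix c d assume c: "c \<in> carrier N'" and d: "d \<in> carrier N'"
    have "\<beta> (i' (c \<otimes>\<^bsub>N'\<^esub> d)) = i (\<alpha> c \<otimes>\<^bsub>N\<^esub> \<alpha> d)"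
      using i'[OF N'.m_closed[OF c d]] hom_mult[OF \<alpha>'(1) c d] by simp
    also have "\<dots> = \<beta> (i' c) \<otimes>\<^bsub>E\<^esub> \<beta> (i' d)"
      using hom_mult[OF i(1) \<alpha>c[OF c] \<alpha>c[OF d]] i'[OF c] i'[OF d] by simp
    also have "\<dots> = \<beta> (i' c \<otimes>\<^bsub>E'\<^esub> i' d)"
      using hom_mult[OF \<beta>'(1)] i'[OF c] i'[OF d] by simp
    finally show "i' (c \<otimes>\<^bsub>N'\<^esub> d) = i' c \<otimes>\<^bsub>E'\<^esub> i' d"
      using inj_onD[OF \<beta>'(2)] i'[OF N'.m_closed[OF c d]] i'[OF c] i'[OF d] E'.m_closed by blast
  qed (use i' in blast)
  moreover have "inj_on i' (carrier N')"
  proof (rule inj_onI)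
    fix c d assume c: "c \<in> carrier N'" and d: "d \<in> carrier N'" and "i' c = i' d"
    then have "i (\<alpha> c) = i (\<alpha> d)"
      using i'[OF c] i'[OF d] by simp
    then have "\<alpha> c = \<alpha> d"
      using inj_onD[OF i(2)] \<alpha>c c d by blast
    then show "c = d"
      using inj_onD[OF \<alpha>'(2)] c d by blast
  qed
  moreover have "p' \<in> hom E' Q"
  proof (rule homI)
    fix c d assume c: "c \<in> carrier E'" and d: "d \<in> carrier E'"
    show "p' (c \<otimes>\<^bsub>E'\<^esub> d) = p' c \<otimes>\<^bsub>Q\<^esub> p' d"
      using p'[OF E'.m_closed[OF c d]] p'[OF c] p'[OF d] hom_mult[OF \<beta>'(1) c d]
        hom_mult[OF p(1) \<beta>c[OF c] \<beta>c[OF d]] by simp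
  qed (use p' p(2) \<beta>c in auto)
  moreover have "p' ` carrier E' = carrier Q"
  proof -
    have "p' ` carrier E' = p ` \<beta> ` carrier E'"
      unfolding image_image using p' by (rule image_cong[OF refl])
    then show ?thesis using p(2) \<beta>'(3) by simp
  qed
  moreover have "kernel E' Q p' = i' ` carrier N'"
  proof (intro antisym subsetI)
    fix c assume "c \<in> kernel E' Q p'"
    then have c: "c \<in> carrier E'" "p (\<beta> c) = \<one>\<^bsub>Q\<^esub>"
      using p' by (auto simp: kernel_def)
    then have "\<beta> c \<in> i ` carrier N"
      unfolding ker[symmetric] using \<beta>c by (simp add: kernel_def)
    then obtain d where d: "d \<in> carrier N'" "\<beta> c = i (\<alpha> d)"
      unfolding \<alpha>'(3)[symmetric] by blast
    then have "c = i' d"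
      using inj_onD[OF \<beta>'(2)] i'[OF d(1)] c(1) by metis
    with d(1) show "c \<in> i' ` carrier N'" by blast
  next
    fix c assume "c \<in> i' ` carrier N'"
    then obtain d where d: "d \<in> carrier N'" "c = i' d" by blast
    then have c: "c \<in> carrier E'" "\<beta> c = i (\<alpha> d)"
      using i' by auto
    then have "\<beta> c \<in> kernel E Q p"
      unfolding ker using \<alpha>c[OF d(1)] by simp
    then show "c \<in> kernel E' Q p'"
      using c(1) p' by (simp add: kernel_def)
  qed
  ultimately show ?thesis
    using ext assms(4,5) by (simp add: group_extension_def mon_def epi_def)
qed

section \<open>Orbit spaces\<close>

context continuous_action
begin

lemma topspace_orbit_space: "topspace (orbit_space \<Gamma> X \<psi>) = orbits \<Gamma> (topspace X) \<psi>"
proof (rule antisym)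
  show "topspace (orbit_space \<Gamma> X \<psi>) \<subseteq> orbits \<Gamma> (topspace X) \<psi>"
    using openin_topspace[of "orbit_space \<Gamma> X \<psi>"] unfolding openin_orbit_space by simp
  have "{x \<in> topspace X. orbit \<Gamma> \<psi> x \<in> orbits \<Gamma> (topspace X) \<psi>} = topspace X"
    by (auto simp: orbits_def)
  then have "openin (orbit_space \<Gamma> X \<psi>) (orbits \<Gamma> (topspace X) \<psi>)"
    unfolding openin_orbit_space by simp
  then show "orbits \<Gamma> (topspace X) \<psi> \<subseteq> topspace (orbit_space \<Gamma> X \<psi>)"
    by (rule openin_subset)
qed

lemma image_orbit: "orbit \<Gamma> \<psi> ` topspace X = topspace (orbit_space \<Gamma> X \<psi>)"
  unfolding topspace_orbit_space orbits_def by blast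

lemma continuous_map_orbit: "continuous_map X (orbit_space \<Gamma> X \<psi>) (orbit \<Gamma> \<psi>)"
  unfolding continuous_map_def
proof (intro conjI allI impI)
  show "orbit \<Gamma> \<psi> \<in> topspace X \<rightarrow> topspace (orbit_space \<Gamma> X \<psi>)"
    unfolding image_orbit[symmetric] by blast
  show "openin X {x \<in> topspace X. orbit \<Gamma> \<psi> x \<in> U}" if "openin (orbit_space \<Gamma> X \<psi>) U" for U
    using that unfolding openin_orbit_space by simp
qed

lemma orbit_eq_iff:
  assumes x: "x \<in> topspace X" and y: "y \<in> topspace X"
  shows "orbit \<Gamma> \<psi> x = orbit \<Gamma> \<psi> y \<longleftrightarrow> (\<exists>\<gamma>\<in>carrier \<Gamma>. y = \<psi> \<gamma> x)"
proof
  assume eq: "orbit \<Gamma> \<psi> x = orbit \<Gamma> \<psi> y"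
  have "\<psi> \<one> y \<in> orbit \<Gamma> \<psi> y"
    unfolding orbit_def by blast
  then have "y \<in> orbit \<Gamma> \<psi> x"
    unfolding eq act_one[OF y] .
  then show "\<exists>\<gamma>\<in>carrier \<Gamma>. y = \<psi> \<gamma> x"
    unfolding orbit_def by blast
next
  assume "\<exists>\<gamma>\<in>carrier \<Gamma>. y = \<psi> \<gamma> x"
  then obtain \<gamma> where \<gamma>: "\<gamma> \<in> carrier \<Gamma>" "y = \<psi> \<gamma> x" by blast
  show "orbit \<Gamma> \<psi> x = orbit \<Gamma> \<psi> y"
  proof (intro antisym subsetI)
    fix z assume "z \<in> orbit \<Gamma> \<psi> x"
    then obtain \<delta> where \<delta>: "\<delta> \<in> carrier \<Gamma>" "z = \<psi> \<delta> x"
      unfolding orbit_def by blast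
    have "\<psi> (\<delta> \<otimes> inv \<gamma>) y = \<psi> \<delta> (\<psi> (inv \<gamma>) y)"
      using act_mult[OF \<delta>(1) inv_closed[OF \<gamma>(1)] y] .
    also have "\<psi> (inv \<gamma>) y = x"
      unfolding \<gamma>(2) by (rule act_inv[OF \<gamma>(1) x])
    finally have "z = \<psi> (\<delta> \<otimes> inv \<gamma>) y"
      using \<delta>(2) by simp
    then show "z \<in> orbit \<Gamma> \<psi> y"
      unfolding orbit_def using \<gamma>(1) \<delta>(1) by blast
  next
    fix z assume "z \<in> orbit \<Gamma> \<psi> y"
    then obtain \<delta> where \<delta>: "\<delta> \<in> carrier \<Gamma>" "z = \<psi> \<delta> y"
      unfolding orbit_def by blast
    then have "z = \<psi> (\<delta> \<otimes> \<gamma>) x"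
      using act_mult[OF \<delta>(1) \<gamma>(1) x] \<gamma>(2) by simp
    then show "z \<in> orbit \<Gamma> \<psi> x"
      unfolding orbit_def using \<gamma>(1) \<delta>(1) by blast
  qed
qed

text \<open>The saturation of an open set is the union of its preimages under the continuous maps of
  the action.\<close>

lemma open_map_orbit: "open_map X (orbit_space \<Gamma> X \<psi>) (orbit \<Gamma> \<psi>)"
  unfolding open_map_def
proof (intro allI impI)
  fix U assume U: "openin X U"
  then have UX: "U \<subseteq> topspace X" by (rule openin_subset)
  have "{x \<in> topspace X. orbit \<Gamma> \<psi> x \<in> orbit \<Gamma> \<psi> ` U} = (\<Union>\<gamma>\<in>carrier \<Gamma>. {x \<in> topspace X. \<psi> \<gamma> x \<in> U})"
  proof (intro antisym subsetI)
    fix x assume "x \<in> {x \<in> topspace X. orbit \<Gamma> \<psi> x \<in> orbit \<Gamma> \<psi> ` U}"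
    then obtain u where u: "x \<in> topspace X" "u \<in> U" "orbit \<Gamma> \<psi> x = orbit \<Gamma> \<psi> u" by blast
    then obtain \<gamma> where "\<gamma> \<in> carrier \<Gamma>" "u = \<psi> \<gamma> x"
      using orbit_eq_iff[of x u] UX by auto
    with u show "x \<in> (\<Union>\<gamma>\<in>carrier \<Gamma>. {x \<in> topspace X. \<psi> \<gamma> x \<in> U})" by blast
  next
    fix x assume "x \<in> (\<Union>\<gamma>\<in>carrier \<Gamma>. {x \<in> topspace X. \<psi> \<gamma> x \<in> U})"
    then obtain \<gamma> where \<gamma>: "\<gamma> \<in> carrier \<Gamma>" "x \<in> topspace X" "\<psi> \<gamma> x \<in> U" by blast
    then have "orbit \<Gamma> \<psi> x = orbit \<Gamma> \<psi> (\<psi> \<gamma> x)"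
      using orbit_eq_iff act_closed by blast
    with \<gamma> show "x \<in> {x \<in> topspace X. orbit \<Gamma> \<psi> x \<in> orbit \<Gamma> \<psi> ` U}" by simp
  qed
  moreover have "openin X (\<Union>\<gamma>\<in>carrier \<Gamma>. {x \<in> topspace X. \<psi> \<gamma> x \<in> U})"
    using openin_continuous_map_preimage[OF cont_act U] by (intro openin_Union) blast
  moreover have "orbit \<Gamma> \<psi> ` U \<subseteq> orbits \<Gamma> (topspace X) \<psi>"
    using UX unfolding orbits_def by blast
  ultimately show "openin (orbit_space \<Gamma> X \<psi>) (orbit \<Gamma> \<psi> ` U)"
    unfolding openin_orbit_space by simp
qed

lemma free_finite_wandering:
  assumes fin: "finite (carrier \<Gamma>)" and haus: "Hausdorff_space X"
    and free: "\<And>\<gamma> x. \<gamma> \<in> carrier \<Gamma> \<Longrightarrow> x \<in> topspace X \<Longrightarrow> \<psi> \<gamma> x = x \<Longrightarrow> \<gamma> = \<one>"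
    and x: "x \<in> topspace X"
  shows "\<exists>U. openin X U \<and> x \<in> U \<and> (\<forall>\<gamma>\<in>carrier \<Gamma>. \<forall>u\<in>U. \<psi> \<gamma> u \<in> U \<longrightarrow> \<gamma> = \<one>)"
proof -
  have "\<exists>W. openin X W \<and> x \<in> W \<and> (\<forall>u\<in>W. \<psi> \<gamma> u \<notin> W)" if \<gamma>: "\<gamma> \<in> carrier \<Gamma> - {\<one>}" for \<gamma>
  proof -
    have "\<psi> \<gamma> x \<noteq> x" "\<psi> \<gamma> x \<in> topspace X"
      using free[of \<gamma> x] \<gamma> x act_closed by auto
    then obtain A B where AB: "openin X A" "openin X B" "x \<in> A" "\<psi> \<gamma> x \<in> B" "disjnt A B"
      using haus x unfolding Hausdorff_space_def by metis
    \<comment> \<open>\<open>A\<close> and \<open>B\<close> separate \<open>x\<close> from its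
      translate; points of \<open>A\<close> sent into \<open>B\<close> do not return to
      \<open>A\<close>.\<close>
    let ?W = "A \<inter> {u \<in> topspace X. \<psi> \<gamma> u \<in> B}"
    have "openin X ?W"
      using AB(1) openin_continuous_map_preimage[OF cont_act AB(2)] \<gamma> by (simp add: openin_Int)
    moreover have "x \<in> ?W" using AB x by simp
    moreover have "\<forall>u\<in>?W. \<psi> \<gamma> u \<notin> ?W"
      using AB(5) unfolding disjnt_def by blast
    ultimately show ?thesis by blast
  qed
  then obtain W where W: "\<And>\<gamma>. \<gamma> \<in> carrier \<Gamma> - {\<one>} \<Longrightarrow> openin X (W \<gamma>) \<and> x \<in> W \<gamma> \<and> (\<forall>u\<in>W \<gamma>. \<psi> \<gamma> u \<notin> W \<gamma>)"
    by metis
  \<comment> \<open>For the trivial group the intersection is over no sets, hence everything;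
    intersecting with the space keeps the set open in \<open>X\<close>.\<close>
  let ?U = "(\<Inter>\<gamma>\<in>carrier \<Gamma> - {\<one>}. W \<gamma>) \<inter> topspace X"
  have open_U: "openin X ?U"
    using fin W by (intro openin_INT) auto
  have x_U: "x \<in> ?U" using W x by blast
  have wander: "\<gamma> = \<one>" if "\<gamma> \<in> carrier \<Gamma>" "u \<in> ?U" "\<psi> \<gamma> u \<in> ?U" for \<gamma> u
  proof (rule ccontr)
    assume "\<gamma> \<noteq> \<one>"
    then have \<gamma>: "\<gamma> \<in> carrier \<Gamma> - {\<one>}" using that(1) by blast
    then have "u \<in> W \<gamma>" "\<psi> \<gamma> u \<in> W \<gamma>" using that(2,3) by blast+
    then show False using W[OF \<gamma>] by blast
  qed
  show ?thesis
    using open_U x_U wander by (intro exI[of _ ?U] conjI ballI impI)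
qed

end

lemma free_G_space_continuous_action:
  assumes "group G" "free_G_space G E \<phi>"
  shows "continuous_action G E \<phi>"
proof -
  interpret group G by fact
  interpret group_action G "topspace E" \<phi>
    using assms(2) by (simp add: free_G_space_def)
  show ?thesis
  proof
    show "continuous_map E E (\<phi> \<gamma>)" if "\<gamma> \<in> carrier G" for \<gamma>
      using assms(2) that by (simp add: free_G_space_def)
    show "\<phi> \<one>\<^bsub>G\<^esub> x = x" if "x \<in> topspace E" for x
      using that by (simp add: id_eq_one[symmetric])
    show "\<phi> (\<gamma> \<otimes>\<^bsub>G\<^esub> \<delta>) x = \<phi> \<gamma> (\<phi> \<delta> x)" if "\<gamma> \<in> carrier G" "\<delta> \<in> carrier G" "x \<in> topspace E" for \<gamma> \<delta> x
      using composition_rule that by blast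
  qed
qed

lemma free_G_space_covering:
  assumes "group G" "finite (carrier G)" "free_G_space G E \<phi>" "contractible_space E" "e0 \<in> topspace E"
  shows "universal_covering_action G E \<phi> (orbit_space G E \<phi>) (orbit G \<phi>) e0"
proof -
  interpret continuous_action G E \<phi>
    by (rule free_G_space_continuous_action[OF assms(1,3)])
  show ?thesis
  proof
    show "continuous_map E (orbit_space G E \<phi>) (orbit G \<phi>)" by (rule continuous_map_orbit)
    show "open_map E (orbit_space G E \<phi>) (orbit G \<phi>)" by (rule open_map_orbit)
    show "orbit G \<phi> ` topspace E = topspace (orbit_space G E \<phi>)" by (rule image_orbit)
    show "orbit G \<phi> x = orbit G \<phi> y \<longleftrightarrow> (\<exists>\<gamma>\<in>carrier G. y = \<phi> \<gamma> x)"
      if "x \<in> topspace E" "y \<in> topspace E" for x y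
      using that by (rule orbit_eq_iff)
    show "\<exists>U. openin E U \<and> x \<in> U \<and> (\<forall>\<gamma>\<in>carrier G. \<forall>u\<in>U. \<phi> \<gamma> u \<in> U \<longrightarrow> \<gamma> = \<one>\<^bsub>G\<^esub>)"
      if "x \<in> topspace E" for x
      using assms(3) that by (intro free_finite_wandering[OF assms(2)]) (auto simp: free_G_space_def)
  qed (rule assms)+
qed

section \<open>The three coverings\<close>

lemma open_map_prod_id:
  assumes f: "open_map X Y f"
  shows "open_map (prod_topology X Z) (prod_topology Y Z) (\<lambda>(x, z). (f x, z))"
  unfolding open_map_def
proof (intro allI impI)
  fix U assume U: "openin (prod_topology X Z) U"
  show "openin (prod_topology Y Z) ((\<lambda>(x, z). (f x, z)) ` U)"
    unfolding openin_prod_topology_alt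
  proof (intro allI impI)
    fix y z assume "(y, z) \<in> (\<lambda>(x, z). (f x, z)) ` U"
    then obtain x where x: "(x, z) \<in> U" "y = f x" by auto
    obtain A B where AB: "openin X A" "openin Z B" "x \<in> A" "z \<in> B" "A \<times> B \<subseteq> U"
      using iffD1[OF openin_prod_topology_alt U, rule_format, OF x(1)] by (elim exE conjE)
    have "openin Y (f ` A)"
      using f AB(1) by (simp add: open_map_def)
    moreover have "f ` A \<times> B \<subseteq> (\<lambda>(x, z). (f x, z)) ` U"
      using AB(5) by force
    ultimately show "\<exists>A B. openin Y A \<and> openin Z B \<and> y \<in> A \<and> z \<in> B \<and> A \<times> B \<subseteq> (\<lambda>(x, z). (f x, z)) ` U"
      using AB(2,3,4) x(2) by blast
  qed
qed

definition space_group_action ::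
  "((real^'n \<Rightarrow> real^'n) \<Rightarrow> 'e \<Rightarrow> 'e) \<Rightarrow> (real^'n \<Rightarrow> real^'n) \<Rightarrow> (real^'n) \<times> 'e \<Rightarrow> (real^'n) \<times> 'e" where
  "space_group_action \<phi> f = (\<lambda>(y, e). (f y, \<phi> (rot_part f) e))"

lemma continuous_map_isometry:
  assumes "orientation_preserving_isometry f"
  shows "continuous_map euclidean euclidean f"
proof -
  have "continuous_on UNIV f"
    using assms unfolding orientation_preserving_isometry_def continuous_on_iff by metis
  then show ?thesis by simp
qed

lemma contractible_euclidean: "contractible_space (euclidean :: (real^'n) topology)"
  using contractible_space_top_of_set[of "UNIV :: (real^'n) set"] by (simp add: convex_imp_contractible)

context periodic
begin

text \<open>Translating by \<open>- y\<close> and then rotating is the same as applying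
  \<open>f\<close> and then translating by \<open>- f y\<close>, and \<open>f\<close> preserves
  \<open>T\<close>. Thus the affine action on R^d covers the rotation action on the hull.\<close>

lemma move_rot_part_hull_point:
  assumes "f \<in> carrier (space_group T)"
  shows "move (rot_part f) (hull_point y) = hull_point (f y)"
proof -
  have f: "orientation_preserving_isometry f" "move f T = T"
    using assms by (simp_all add: in_space_group)
  have "rot_part f \<circ> (\<lambda>x. x + - y) = (\<lambda>x. x + - f y) \<circ> f"
  proof
    fix x
    show "(rot_part f \<circ> (\<lambda>x. x + - y)) x = ((\<lambda>x. x + - f y) \<circ> f) x"
      using isometry_add[OF f(1), of y "x - y"] by simp
  qed
  then have "move (rot_part f) (translate (- y) T) = translate (- f y) (move f T)"
    by (simp only: translate_def move_move)
  then show ?thesis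
    by (simp add: hull_point_def f(2))
qed

lemma hull_point_wandering:
  "\<exists>U. open U \<and> y \<in> U \<and> (\<forall>f\<in>carrier (translation_group T). \<forall>u\<in>U. f u \<in> U \<longrightarrow> f = id)"
proof -
  obtain \<delta> where \<delta>: "\<delta> > 0" "\<forall>l\<in>periods T. norm l < \<delta> \<longrightarrow> l = 0"
    using periods_discrete by blast
  have "f = id" if f: "f \<in> carrier (translation_group T)" and u: "u \<in> ball y (\<delta> / 2)" "f u \<in> ball y (\<delta> / 2)" for f u
  proof -
    obtain v where v: "v \<in> periods T" "f = (\<lambda>x. x + v)" using f by auto
    have "norm v = dist (f u) u" by (simp add: v(2) dist_norm)
    also have "\<dots> < \<delta>"
      using u dist_triangle[of "f u" u y] by (simp add: dist_commute)
    finally have "v = 0" using \<delta>(2) v(1) by blast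
    then show ?thesis by (simp add: v(2) fun_eq_iff)
  qed
  then show ?thesis
    using \<delta>(1) by (intro exI[of _ "ball y (\<delta> / 2)"]) simp
qed

lemma hull_covering:
  "universal_covering_action (translation_group T) euclidean (\<lambda>f. f) (transl_hull T) hull_point a"
proof -
  interpret group "translation_group T" by (rule group_translation_group)
  show ?thesis
  proof
    show "continuous_map euclidean euclidean f" if "f \<in> carrier (translation_group T)" for f
      using that continuous_map_isometry[OF orientation_preserving_isometry_translation] by auto
    show "hull_point ` topspace euclidean = topspace (transl_hull T)"
      by (simp add: range_hull_point)
    show "hull_point x = hull_point y \<longleftrightarrow> (\<exists>f\<in>carrier (translation_group T). y = f x)" for x y
    proof -
      have "y - x \<in> periods T \<longleftrightarrow> (\<exists>v\<in>periods T. y = x + v)"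
        by (metis add_diff_cancel_left' diff_add_cancel add.commute)
      then show ?thesis by (simp add: hull_point_eq_iff)
    qed
    show "\<exists>U. openin euclidean U \<and> y \<in> U \<and>
        (\<forall>f\<in>carrier (translation_group T). \<forall>u\<in>U. f u \<in> U \<longrightarrow> f = \<one>\<^bsub>translation_group T\<^esub>)" for y
      using hull_point_wandering[of y] by simp
  qed (simp_all add: continuous_hull_point open_hull_point contractible_euclidean)
qed

text \<open>Continuity descends from the isometry \<open>f\<close> of R^d, because
  \<open>hull_point\<close> is a quotient map.\<close>

lemma continuous_map_move_rot_part:
  assumes "g \<in> carrier (point_group T)"
  shows "continuous_map (transl_hull T) (transl_hull T) (move g)"
proof -
  obtain f where f: "f \<in> carrier (space_group T)" "g = rot_part f"
    using assms by auto
  have "quotient_map euclidean (transl_hull T) hull_point"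
    by (rule continuous_open_imp_quotient_map[OF continuous_hull_point open_hull_point])
      (simp add: range_hull_point)
  moreover have "continuous_map euclidean (transl_hull T) (move g \<circ> hull_point)"
  proof -
    have "move g \<circ> hull_point = hull_point \<circ> f"
      by (simp add: fun_eq_iff f(2) move_rot_part_hull_point[OF f(1)])
    moreover have "continuous_map euclidean euclidean f"
      using f(1) by (intro continuous_map_isometry) (simp add: in_space_group)
    then have "continuous_map euclidean (transl_hull T) (hull_point \<circ> f)"
      by (rule continuous_map_compose[OF _ continuous_hull_point])
    ultimately show ?thesis
      by (simp only:)
  qed
  ultimately show ?thesis
    by (rule continuous_compose_quotient_map)
qed

definition borel_point :: "((real^'n \<Rightarrow> real^'n) \<Rightarrow> 'e \<Rightarrow> 'e) \<Rightarrow> (real^'n) \<times> 'e \<Rightarrow> (('l \<times> (real^'n) set) set \<times> 'e) set" where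
  "borel_point \<phi> = (\<lambda>(y, e). orbit (point_group T) (diagonal_action \<phi>) (hull_point y, e))"

context
  fixes E :: "'e topology" and \<phi> :: "(real^'n \<Rightarrow> real^'n) \<Rightarrow> 'e \<Rightarrow> 'e"
  assumes E: "free_G_space (point_group T) E \<phi>"
begin

interpretation G: continuous_action "point_group T" E \<phi>
  by (rule free_G_space_continuous_action[OF group_point_group E])

lemma diagonal_continuous_action:
  "continuous_action (point_group T) (prod_topology (transl_hull T) E) (diagonal_action \<phi>)"
proof
  show "continuous_map (prod_topology (transl_hull T) E) (prod_topology (transl_hull T) E) (diagonal_action \<phi> g)"
    if "g \<in> carrier (point_group T)" for g
    unfolding diagonal_action_def continuous_map_prod_top
    using continuous_map_move_rot_part[OF that] G.cont_act[OF that] by simp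
  show "diagonal_action \<phi> \<one>\<^bsub>point_group T\<^esub> z = z" if "z \<in> topspace (prod_topology (transl_hull T) E)" for z
    using that G.act_one by (cases z) (simp add: diagonal_action_def)
  show "diagonal_action \<phi> (g \<otimes>\<^bsub>point_group T\<^esub> h) z = diagonal_action \<phi> g (diagonal_action \<phi> h z)"
    if "g \<in> carrier (point_group T)" "h \<in> carrier (point_group T)" "z \<in> topspace (prod_topology (transl_hull T) E)" for g h z
    using that G.act_mult[OF that(1,2)] by (cases z) (simp add: diagonal_action_def move_move)
qed

interpretation D: continuous_action "point_group T" "prod_topology (transl_hull T) E" "diagonal_action \<phi>"
  by (rule diagonal_continuous_action)

lemma borel_point_eq_iff:
  assumes "e \<in> topspace E" "e' \<in> topspace E"
  shows "borel_point \<phi> (y, e) = borel_point \<phi> (y', e') \<longleftrightarrow>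
    (\<exists>f\<in>carrier (space_group T). (y', e') = space_group_action \<phi> f (y, e))"
proof -
  have top: "(hull_point z, w) \<in> topspace (prod_topology (transl_hull T) E)" if "w \<in> topspace E" for z w
    using that range_hull_point by auto
  have "borel_point \<phi> (y, e) = borel_point \<phi> (y', e') \<longleftrightarrow>
      (\<exists>g\<in>carrier (point_group T). (hull_point y', e') = diagonal_action \<phi> g (hull_point y, e))"
    unfolding borel_point_def prod.case by (rule D.orbit_eq_iff[OF top[OF assms(1)] top[OF assms(2)]])
  also have "\<dots> \<longleftrightarrow> (\<exists>f\<in>carrier (space_group T). hull_point y' = hull_point (f y) \<and> e' = \<phi> (rot_part f) e)"
    by (simp add: diagonal_action_def move_rot_part_hull_point)
  also have "\<dots> \<longleftrightarrow> (\<exists>f\<in>carrier (space_group T). (y', e') = space_group_action \<phi> f (y, e))"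
  proof
    assume "\<exists>f\<in>carrier (space_group T). hull_point y' = hull_point (f y) \<and> e' = \<phi> (rot_part f) e"
    then obtain f where f: "f \<in> carrier (space_group T)" "hull_point y' = hull_point (f y)" "e' = \<phi> (rot_part f) e"
      by blast
    \<comment> \<open>Equal hull points determine \<open>f y\<close> only up to a period. Composing
      with that translation hits \<open>y'\<close> exactly and leaves the rotational part, hence the
      action on \<open>E\<close>, unchanged.\<close>
    let ?t = "\<lambda>x. x + (y' - f y)"
    have t: "?t \<in> carrier (space_group T)"
      using f(2)[symmetric] by (intro translation_in_space_group) (simp add: hull_point_eq_iff)
    have "rot_part (?t \<circ> f) = rot_part f"
      using rot_part_space_group_comp[OF t] by simp
    moreover have "(?t \<circ> f) y = y'" by simp
    ultimately have "(y', e') = space_group_action \<phi> (?t \<circ> f) (y, e)"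
      using f(3) unfolding space_group_action_def prod.case by (simp only:)
    then show "\<exists>f\<in>carrier (space_group T). (y', e') = space_group_action \<phi> f (y, e)"
      by (rule bexI[where x = "?t \<circ> f", OF _ space_group_comp[OF t f(1)]])
  next
    assume "\<exists>f\<in>carrier (space_group T). (y', e') = space_group_action \<phi> f (y, e)"
    then show "\<exists>f\<in>carrier (space_group T). hull_point y' = hull_point (f y) \<and> e' = \<phi> (rot_part f) e"
      by (auto simp: space_group_action_def)
  qed
  finally show ?thesis .
qed

lemma borel_covering:
  assumes contr: "contractible_space E" and e0: "e0 \<in> topspace E"
  shows "universal_covering_action (space_group T) (prod_topology euclidean E) (space_group_action \<phi>)
    (borel_hull T E \<phi>) (borel_point \<phi>) (a, e0)"
proof -
  interpret group "space_group T" by (rule group_space_group)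
  let ?X = "prod_topology (euclidean :: (real^'n) topology) E"
  let ?H = "prod_topology (transl_hull T) E"
  let ?q = "\<lambda>(y, e). (hull_point y, e)"
  \<comment> \<open>Factoring through the product of hull and \<open>E\<close> splits the map into
    two continuous open surjections.\<close>
  have q: "borel_point \<phi> = orbit (point_group T) (diagonal_action \<phi>) \<circ> ?q"
    by (simp add: borel_point_def fun_eq_iff split: prod.split)
  have rot: "rot_part f \<in> carrier (point_group T)" if "f \<in> carrier (space_group T)" for f
    using that by simp
  show ?thesis
  proof
    show "continuous_map ?X ?X (space_group_action \<phi> f)" if f: "f \<in> carrier (space_group T)" for f
      unfolding space_group_action_def continuous_map_prod_top
      using G.cont_act[OF rot[OF f]] continuous_map_isometry[of f] f by (simp add: in_space_group)
    show "space_group_action \<phi> \<one>\<^bsub>space_group T\<^esub> x = x" if "x \<in> topspace ?X" for x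
      using that G.act_one by (cases x) (simp add: space_group_action_def)
    show "space_group_action \<phi> (f \<otimes>\<^bsub>space_group T\<^esub> g) x = space_group_action \<phi> f (space_group_action \<phi> g x)"
      if "f \<in> carrier (space_group T)" "g \<in> carrier (space_group T)" "x \<in> topspace ?X" for f g x
      using that G.act_mult[OF rot[OF that(1)] rot[OF that(2)]]
      by (cases x) (simp add: space_group_action_def rot_part_space_group_comp)
    have "continuous_map ?X ?H ?q"
      unfolding continuous_map_prod_top using continuous_hull_point by simp
    then show "continuous_map ?X (borel_hull T E \<phi>) (borel_point \<phi>)"
      unfolding q borel_hull_def by (rule continuous_map_compose[OF _ D.continuous_map_orbit])
    show "open_map ?X (borel_hull T E \<phi>) (borel_point \<phi>)"
      unfolding q borel_hull_def
      by (rule open_map_compose[OF open_map_prod_id[OF open_hull_point] D.open_map_orbit])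
    have "?q ` topspace ?X = topspace ?H"
    proof -
      have "?q ` topspace ?X = range hull_point \<times> topspace E" by force
      then show ?thesis by (simp add: range_hull_point)
    qed
    then show "borel_point \<phi> ` topspace ?X = topspace (borel_hull T E \<phi>)"
      unfolding q borel_hull_def image_comp[symmetric] by (simp only: D.image_orbit)
    show "borel_point \<phi> x = borel_point \<phi> x' \<longleftrightarrow> (\<exists>f\<in>carrier (space_group T). x' = space_group_action \<phi> f x)"
      if "x \<in> topspace ?X" "x' \<in> topspace ?X" for x x'
      using that borel_point_eq_iff by (cases x; cases x') simp
    show "\<exists>U. openin ?X U \<and> x \<in> U \<and> (\<forall>f\<in>carrier (space_group T). \<forall>u\<in>U. space_group_action \<phi> f u \<in> U \<longrightarrow> f = \<one>\<^bsub>space_group T\<^esub>)"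
      if x: "x \<in> topspace ?X" for x
    proof -
      obtain y e where ye: "x = (y, e)" "e \<in> topspace E"
        using x by (cases x) simp
      obtain U where U: "open U" "y \<in> U" "\<forall>f\<in>carrier (translation_group T). \<forall>u\<in>U. f u \<in> U \<longrightarrow> f = id"
        using hull_point_wandering[of y] by (elim exE conjE)
      obtain W where W: "openin E W" "e \<in> W"
          "\<forall>g\<in>carrier (point_group T). \<forall>u\<in>W. \<phi> g u \<in> W \<longrightarrow> g = \<one>\<^bsub>point_group T\<^esub>"
        using G.free_finite_wandering[OF finite_point_group _ _ ye(2)] E unfolding free_G_space_def by metis
      have "f = id" if f: "f \<in> carrier (space_group T)" and u: "u \<in> U \<times> W" "space_group_action \<phi> f u \<in> U \<times> W" for f u
      proof -
        obtain z w where zw: "u = (z, w)" "z \<in> U" "w \<in> W" using u(1) by blast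
        have "f z \<in> U" "\<phi> (rot_part f) w \<in> W"
          using u(2) by (simp_all add: zw(1) space_group_action_def)
        then have "rot_part f = id"
          using W(3)[rule_format, OF rot[OF f] zw(3)] by simp
        then have "f \<in> carrier (translation_group T)"
          by (rule space_group_rot_part_id[OF f])
        then show ?thesis
          using U(3) zw(2) \<open>f z \<in> U\<close> by blast
      qed
      then show ?thesis
        using U(1,2) W(1,2) ye(1)
        by (intro exI[of _ "U \<times> W"]) (simp add: openin_prod_Times_iff)
    qed
    show "(a, e0) \<in> topspace ?X"
      using e0 by simp
    show "contractible_space ?X"
      by (simp add: contractible_space_prod_topology contractible_euclidean contr)
  qed
qed

end

end

theorem corollary5p10:
  fixes T T0 :: "('l \<times> (real^'n) set) set"
    and EG :: "'e topology"
    and \<phi> :: "(real^'n \<Rightarrow> real^'n) \<Rightarrow> 'e \<Rightarrow> 'e"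
    and e0 :: 'e
  defines "G \<equiv> point_group T"
    and "\<Omega>\<^sub>G \<equiv> borel_hull T EG \<phi>"
    and "BG \<equiv> classifying_space T EG \<phi>"
    and "x0 \<equiv> borel_fibre T \<phi> e0 T0"
    and "b0 \<equiv> orbit (point_group T) \<phi> e0"
  defines "\<pi>\<Omega>\<^sub>t \<equiv> fundamental_group (transl_hull T) T0"
    and "\<pi>\<Omega>\<^sub>G \<equiv> fundamental_group \<Omega>\<^sub>G x0"
    and "\<pi>BG \<equiv> fundamental_group BG b0"
    and "i \<equiv> induced_map \<Omega>\<^sub>G x0 (borel_fibre T \<phi> e0)"
    and "p \<equiv> induced_map BG b0 borel_projection"
    and "\<mu> \<equiv> monodromy G EG \<phi> e0"
  assumes "CARD('n) \<ge> 2"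
    and "periodic_tiling T"
    and "free_G_space G EG \<phi>" and "contractible_space EG"
    and "T0 \<in> topspace (transl_hull T)" and "e0 \<in> topspace EG"
  shows "group_extension (translation_group T) (space_group T) G id rot_part
    \<and> translation_group T \<cong> Z_power TYPE('n)
    \<and> \<pi>\<Omega>\<^sub>t \<cong> Z_power TYPE('n)
    \<and> \<mu> \<in> iso \<pi>BG G
    \<and> group_extension \<pi>\<Omega>\<^sub>t \<pi>\<Omega>\<^sub>G G i (\<mu> \<circ> p)
    \<and> \<pi>\<Omega>\<^sub>G \<cong> space_group T
    \<and> (\<exists>\<alpha> \<beta>. \<alpha> \<in> iso \<pi>\<Omega>\<^sub>t (translation_group T) \<and> \<beta> \<in> iso \<pi>\<Omega>\<^sub>G (space_group T)
         \<and> (\<forall>c\<in>carrier \<pi>\<Omega>\<^sub>t. \<beta> (i c) = id (\<alpha> c))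
         \<and> (\<forall>c\<in>carrier \<pi>\<Omega>\<^sub>G. rot_part (\<beta> c) = \<mu> (p c)))"
proof -
  interpret periodic T
    by unfold_locales fact
  note free = \<open>free_G_space G EG \<phi>\<close>[unfolded G_def]
  note contr = \<open>contractible_space EG\<close> and e0 = \<open>e0 \<in> topspace EG\<close>
  obtain a where a: "T0 = hull_point a"
    using \<open>T0 \<in> topspace (transl_hull T)\<close> range_hull_point by auto
  interpret H: universal_covering_action "translation_group T" euclidean "\<lambda>f. f" "transl_hull T" hull_point a
    by (rule hull_covering)
  interpret B: universal_covering_action "point_group T" EG \<phi> BG "orbit (point_group T) \<phi>" e0
    unfolding BG_def classifying_space_def
    by (rule free_G_space_covering[OF group_point_group finite_point_group free contr e0])
  interpret C: universal_covering_action "space_group T" "prod_topology euclidean EG" "space_group_action \<phi>"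
      \<Omega>\<^sub>G "borel_point \<phi>" "(a, e0)"
    unfolding \<Omega>\<^sub>G_def by (rule borel_covering[OF free contr e0])
  have x0: "x0 = borel_point \<phi> (a, e0)"
    by (simp add: x0_def borel_fibre_def borel_point_def a)
  have \<pi>: "\<pi>\<Omega>\<^sub>t = fundamental_group (transl_hull T) (hull_point a)"
      "\<pi>\<Omega>\<^sub>G = fundamental_group \<Omega>\<^sub>G (borel_point \<phi> (a, e0))"
      "\<pi>BG = fundamental_group BG (orbit (point_group T) \<phi> e0)"
    by (simp_all add: \<pi>\<Omega>\<^sub>t_def \<pi>\<Omega>\<^sub>G_def \<pi>BG_def x0 b0_def a)
  have \<mu>: "\<mu> = B.holonomy"
    by (rule ext) (simp add: \<mu>_def G_def monodromy_def B.holonomy_def)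
  have i: "i (H.deck_class f) = C.deck_class f" if f: "f \<in> carrier (translation_group T)" for f
    unfolding i_def x0
  proof (rule induced_map_deck_class[OF H.universal_covering_action_axioms C.universal_covering_action_axioms])
    show "continuous_map euclidean (prod_topology euclidean EG) (\<lambda>y. (y, e0))"
      using e0 by (intro continuous_map_pairedI) simp_all
    show "borel_point \<phi> (y, e0) = borel_fibre T \<phi> e0 (hull_point y)" for y
      by (simp add: borel_point_def borel_fibre_def)
    obtain v where v: "v \<in> periods T" "f = (\<lambda>x. x + v)" using f by auto
    show "f \<in> carrier (space_group T)"
      unfolding v(2) by (rule translation_in_space_group[OF v(1)])
    \<comment> \<open>A translation has trivial rotational part, so it fixes the second coordinate;
      it is its own image in the space group.\<close>
    show "(f a, e0) = space_group_action \<phi> f (a, e0)"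
      using B.act_one[OF e0] by (simp add: v(2) space_group_action_def)
  qed (use f in simp_all)
  have p: "p (C.deck_class f) = B.deck_class (rot_part f)" if f: "f \<in> carrier (space_group T)" for f
    unfolding p_def b0_def
  proof (rule induced_map_deck_class[OF C.universal_covering_action_axioms B.universal_covering_action_axioms])
    show "continuous_map (prod_topology euclidean EG) EG snd"
      by (rule continuous_map_snd)
    \<comment> \<open>The second components of a diagonal orbit form the orbit of the second
      component.\<close>
    show "orbit (point_group T) \<phi> (snd x) = borel_projection (borel_point \<phi> x)" for x
      by (cases x) (force simp: borel_projection_def borel_point_def orbit_def diagonal_action_def)
    show "snd (space_group_action \<phi> f (a, e0)) = \<phi> (rot_part f) e0"
      by (simp add: space_group_action_def)
  qed (use f in simp_all)
  have \<alpha>: "H.holonomy \<in> iso \<pi>\<Omega>\<^sub>t (translation_group T)"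
    unfolding \<pi> by (rule H.holonomy_iso)
  have \<beta>: "C.holonomy \<in> iso \<pi>\<Omega>\<^sub>G (space_group T)"
    unfolding \<pi> by (rule C.holonomy_iso)
  have i_comm: "i c \<in> carrier \<pi>\<Omega>\<^sub>G \<and> C.holonomy (i c) = id (H.holonomy c)" if c: "c \<in> carrier \<pi>\<Omega>\<^sub>t" for c
  proof -
    obtain f where f: "f \<in> carrier (translation_group T)" "c = H.deck_class f"
      using c unfolding \<pi> H.carrier_fundamental_group by (elim imageE)
    then have "f \<in> carrier (space_group T)"
      using translation_in_space_group by auto
    then show ?thesis
      unfolding \<pi> C.carrier_fundamental_group f(2) i[OF f(1)]
      by (simp add: C.holonomy_deck_class H.holonomy_deck_class[OF f(1)])
  qed
  have p_comm: "rot_part (C.holonomy c) = \<mu> (p c)" if c: "c \<in> carrier \<pi>\<Omega>\<^sub>G" for c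
  proof -
    obtain f where f: "f \<in> carrier (space_group T)" "c = C.deck_class f"
      using c unfolding \<pi> C.carrier_fundamental_group by (elim imageE)
    have "rot_part f \<in> carrier (point_group T)" using f(1) by simp
    then show ?thesis
      unfolding f(2) p[OF f(1)] \<mu> by (simp only: C.holonomy_deck_class[OF f(1)] B.holonomy_deck_class)
  qed
  have groups: "group \<pi>\<Omega>\<^sub>t" "group \<pi>\<Omega>\<^sub>G"
    unfolding \<pi> by (rule H.group_fundamental_group C.group_fundamental_group)+
  have ext: "group_extension (translation_group T) (space_group T) G id rot_part"
    unfolding G_def by (rule standard_extension)
  show ?thesis
  proof (intro conjI exI ballI)
    show "\<pi>\<Omega>\<^sub>t \<cong> Z_power TYPE('n)"
      using is_isoI[OF \<alpha>] translation_group_iso by (rule iso_trans)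
    show "\<mu> \<in> iso \<pi>BG G"
      unfolding \<mu> \<pi> G_def by (rule B.holonomy_iso)
    show "group_extension \<pi>\<Omega>\<^sub>t \<pi>\<Omega>\<^sub>G G i (\<mu> \<circ> p)"
    proof (rule group_extension_transport[OF ext \<alpha> \<beta> groups])
      show "i c \<in> carrier \<pi>\<Omega>\<^sub>G \<and> C.holonomy (i c) = id (H.holonomy c)" if "c \<in> carrier \<pi>\<Omega>\<^sub>t" for c
        by (rule i_comm[OF that])
      show "(\<mu> \<circ> p) c = rot_part (C.holonomy c)" if "c \<in> carrier \<pi>\<Omega>\<^sub>G" for c
        using p_comm[OF that] by simp
    qed
    show "\<pi>\<Omega>\<^sub>G \<cong> space_group T"
      by (rule is_isoI[OF \<beta>])
    show "C.holonomy (i c) = id (H.holonomy c)" if "c \<in> carrier \<pi>\<Omega>\<^sub>t" for c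
      using i_comm[OF that] by simp
    show "rot_part (C.holonomy c) = \<mu> (p c)" if "c \<in> carrier \<pi>\<Omega>\<^sub>G" for c
      by (rule p_comm[OF that])
  qed (rule ext translation_group_iso \<alpha> \<beta>)+
qed

end
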